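(* Let $X_1,\dots,X_n$ be independent random variables with values in $\mathbb{Z}_+$, and suppose that for each $i$ the probability generating function $M_{X_i}$ satisfies $G_{X_i}(z):=M_{X_i}'(z)/M_{X_i}(z)=\sum_{m=0}^\infty a_{i,m+1}z^m$. Let $Y=\sum_{i=1}^nX_i$ and $$\mu=\sum_{i,m}a_{i,m+1},\ \sigma^2=\sum_{i,m}(m+1)a_{i,m+1},\ \mu_2=\sum_{i,m}m\,a_{i,m+1},\ \mu_3=\sum_{i,m}m(m-1)a_{i,m+1}$$ (sums over $1\le i\le n$, $m\ge0$), and assume $\sigma^2>\mu$. Define $\eta_1=\frac32\mu\mu_3-4\mu_2^2$, $\eta_2=27\mu^2\mu_2^2-16\mu_2^3-\frac{27}{2}\mu^3\mu_3+9\mu\mu_2\mu_3$, $\eta_3=\bigl(\frac{\eta_2+\sqrt{4\eta_1^3+\eta_2^2}}{2}\bigr)^{1/3}$, $\eta=2\mu_2+\eta_1/\eta_3-\eta_3$, assuming $\eta,\eta_3$ are positive reals, and set $$\hat p=\frac{3\mu}{3\mu+\eta},\quad \alpha=\Bigl(\mu-\frac{\eta}{3\mu}\Bigr)^2\Big/\Bigl(\mu_2-\frac{\eta^2}{9\mu^2}\Bigr),\quad p=\Bigl(\mu-\frac{\eta}{3\mu}\Bigr)\Big/\Bigl(\sigma^2-\frac{\eta}{3\mu}\Bigl(\frac{\eta}{3\mu}+1\Bigr)\Bigr),$$ with $\alpha>0$, $p,\hat p\in(0,1)$, $q=1-p$, $\hat q=1-\hat p$, and $r=\alpha+1+\frac{\hat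 q-q}{q\hat p}$. Let $V=Z+W$ with $Z\sim\mathrm{NB}(\alpha,p)$ and $W\sim\mathrm{Ge}(\hat p)$ independent. Let $\Psi=\sum_{i=1}^n\xi_i$ with $\xi_i=\min\{\frac12,\,1-d_{TV}(X_i,X_i+1)\}$. If $rq>|\hat q-q|\frac{\hat q}{\hat p^2}$, then $$d_{TV}(Y,V)\le\frac{16}{\Psi\bigl(rq-|\hat q-q|\frac{\hat q}{\hat p^2}\bigr)}\Bigl(\sum_{i=1}^n\sum_{l=1}^\infty\frac{l(l-1)(l-2)}{6}\bigl|a_{i,l+1}-q\,a_{i,l}\bigr|+\frac{|\hat q-q|\hat q^3}{\hat p^4}\Bigr).$$
   Context: $\mathrm{NB}(\alpha,p)$: $\mathbf{P}(Z=m)=\binom{\alpha+m-1}{m}p^\alpha q^m$, $m\ge0$. $\mathrm{Ge}(\hat p)$: $\mathbf{P}(W=x)=\hat q^x\hat p$, $x\ge0$. $d_{TV}(Y,X)=\frac12\sum_{m\ge0}|\mathbf{P}(Y=m)-\mathbf{P}(X=m)|$. The parameters are chosen (in the paper) to match the first three factorial cumulants: $\frac{\alpha q}{p}+\frac{\hat q}{\hat p}=\mu$, $\frac{\alpha q^2}{p^2}+\frac{\hat q^2}{\hat p^2}=\mu_2$, $\frac{\alpha q^3}{p^3}+\frac{\hat q^3}{\hat p^3}=\frac{\mu_3}{2}$. *)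

theory Defs
  imports "HOL-Probability.Probability" "HOL-Computational_Algebra.Formal_Power_Series"
begin

text \<open>Distributions on the nonnegative integers are handled through their mass
functions (nat to real).\<close>

definition pgf_fps :: "nat pmf \<Rightarrow> real fps" where
  "pgf_fps X = Abs_fps (\<lambda>k. pmf X k)"

text \<open>Convolution of mass functions = law of the sum of independent variables.\<close>
definition conv :: "(nat \<Rightarrow> real) \<Rightarrow> (nat \<Rightarrow> real) \<Rightarrow> nat \<Rightarrow> real" where
  "conv f g m = (\<Sum>k\<le>m. f k * g (m - k))"

fun sum_law :: "(nat \<Rightarrow> nat pmf) \<Rightarrow> nat \<Rightarrow> nat \<Rightarrow> real" where
  "sum_law X 0 = (\<lambda>m. if m = 0 then 1 else 0)"
| "sum_law X (Suc n) = conv (sum_law X n) (pmf (X (Suc n)))"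

definition shift1 :: "(nat \<Rightarrow> real) \<Rightarrow> nat \<Rightarrow> real" where
  "shift1 f m = (if m = 0 then 0 else f (m - 1))"

definition dtv :: "(nat \<Rightarrow> real) \<Rightarrow> (nat \<Rightarrow> real) \<Rightarrow> real" where
  "dtv f g = (1/2) * (\<Sum>m. \<bar>f m - g m\<bar>)"

definition nb_mass :: "real \<Rightarrow> real \<Rightarrow> nat \<Rightarrow> real" where
  "nb_mass \<alpha> p m = ((\<alpha> + real m - 1) gchoose m) * p powr \<alpha> * (1 - p) ^ m"

definition geo_mass :: "real \<Rightarrow> nat \<Rightarrow> real" where
  "geo_mass p x = (1 - p) ^ x * p"

end

theory Submission
  imports Defs
begin

text \<open>
  Write \<open>x = qh / ph\<close>, \<open>y = q / p\<close>, \<open>A = \<alpha> y\<close>, and let \<open>K\<close> be the bracket on the right of the bound. By Cardano's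
  formula \<open>x\<close> solves the cubic which says that the logarithmic derivatives \<open>G\<^sub>Y\<close>, \<open>G\<^sub>V\<close> of the generating functions
  agree at 1 up to second order, so \<open>(1 - q z) (G\<^sub>Y - G\<^sub>V) = (1 - z)^3 D\<close> where the coefficients of \<open>D\<close> have absolute sum
  at most \<open>K\<close>. Moreover \<open>r q = p \<mu>\<close> with \<open>\<mu> = A + x\<close>, \<open>\<gamma> = |qh - q| qh / ph^2 = p |x - y| x\<close>,
  \<open>\<gamma> x^2 \<le> K\<close> and \<open>\<Psi> \<le> \<mu>\<close>.

  If \<open>x \<ge> y\<close>, then either \<open>3 \<gamma> \<ge> r q\<close> and the bound is trivial, or Stein's method for the negative binomial
  distribution with parameter \<open>r\<close>, perturbed by the remaining part of the Stein operator of \<open>V\<close>, gives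
  \<open>d (r q - 2 \<gamma>) \<le> K \<parallel>(1 - z)^2 M\<^sub>Y\<parallel>\<close>; the last norm is at most \<open>8 / \<Psi>\<close> because each \<open>X\<^sub>i\<close> contains a fair coin with
  probability \<open>1 - d\<^sub>T\<^sub>V(X\<^sub>i, X\<^sub>i + 1)\<close>.

  If \<open>x < y\<close>, this argument is too weak, but the real-root form of Cardano's formula forces
  \<open>t^2 + 4 \<eta>\<^sub>1 = (\<eta>\<^sub>1 / \<eta>\<^sub>3 + \<eta>\<^sub>3)^2 \<ge> 0\<close> at the root \<open>t\<close>, which yields \<open>A + x \<le> y\<close>, hence \<open>\<alpha> \<le> 1\<close> and \<open>r q \<le> 1\<close>. Then \<open>V\<close> is
  a sum of two variables with decreasing mass functions, and estimating the quotient
  \<open>M\<^sub>Y / M\<^sub>V\<close>, the exponential of an integral of \<open>G\<^sub>Y - G\<^sub>V\<close>, gives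
  \<open>d \<le> 4 K P(Y = 0) exp (8 K) \<le> 4 K exp (8 K - \<Psi>)\<close>, which suffices unless the claimed bound exceeds 1.
\<close>

section \<open>Absolutely summable power series\<close>

text \<open>The algebra of absolutely convergent power series, with a submultiplicative norm. Total
  variation distance is half the norm of a difference of generating functions
  (\<open>dtv_fps\<close>).\<close>

definition l1 :: "real fps \<Rightarrow> bool" where
  "l1 f \<longleftrightarrow> summable (\<lambda>n. \<bar>fps_nth f n\<bar>)"

definition l1norm :: "real fps \<Rightarrow> real" where
  "l1norm f = (\<Sum>n. \<bar>fps_nth f n\<bar>)"

text \<open>Evaluation at 1. It is additive and multiplicative on \<open>l1\<close> series, so
  matching factorial cumulants means matching derivatives of logarithmic derivatives at 1.\<close>

definition coeff_sum :: "real fps \<Rightarrow> real" where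
  "coeff_sum f = (\<Sum>n. fps_nth f n)"

lemma l1_summable: "l1 f \<Longrightarrow> summable (fps_nth f)"
  unfolding l1_def by (rule summable_rabs_cancel)

lemma l1norm_nonneg: "l1 f \<Longrightarrow> 0 \<le> l1norm f"
  unfolding l1_def l1norm_def by (rule suminf_nonneg) auto

lemma l1_eventually_zero:
  assumes "\<And>n. n \<ge> N \<Longrightarrow> fps_nth f n = 0"
  shows "l1 f" "l1norm f = (\<Sum>n<N. \<bar>fps_nth f n\<bar>)" "coeff_sum f = (\<Sum>n<N. fps_nth f n)"
proof -
  show "l1 f"
    unfolding l1_def by (rule summable_finite[of "{..<N}"]) (use assms in \<open>auto simp: not_less\<close>)
  show "l1norm f = (\<Sum>n<N. \<bar>fps_nth f n\<bar>)" "coeff_sum f = (\<Sum>n<N. fps_nth f n)"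
    unfolding l1norm_def coeff_sum_def by (rule suminf_finite; use assms in \<open>auto simp: not_less\<close>)+
qed

lemma l1_const [simp]: "l1 (fps_const c)" "l1norm (fps_const c) = \<bar>c\<bar>" "coeff_sum (fps_const c) = c"
  using l1_eventually_zero[of 1 "fps_const c"] by auto

lemma l1_0 [simp]: "l1 0" "l1norm 0 = 0" "coeff_sum 0 = 0"
  using l1_const[of 0] by auto

lemma l1_1 [simp]: "l1 1" "l1norm 1 = 1" "coeff_sum 1 = 1"
  using l1_const[of 1] by auto

lemma l1_numeral [simp]: "l1 (numeral k)"
  by (metis l1_const(1) numeral_fps_const)

lemma l1_X [simp]: "l1 fps_X" "l1norm fps_X = 1" "coeff_sum fps_X = 1"
  using l1_eventually_zero[of 2 fps_X] by (auto simp: fps_X_def numeral_2_eq_2)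

lemma l1_add [simp]: "l1 f \<Longrightarrow> l1 g \<Longrightarrow> l1 (f + g)"
  unfolding l1_def by (rule summable_comparison_test'[where g = "\<lambda>n. \<bar>fps_nth f n\<bar> + \<bar>fps_nth g n\<bar>" and N = 0])
    (auto intro: summable_add)

lemma l1norm_add: "l1 f \<Longrightarrow> l1 g \<Longrightarrow> l1norm (f + g) \<le> l1norm f + l1norm g"
  using l1_add[of f g] unfolding l1_def l1norm_def
  by (subst suminf_add) (auto intro!: suminf_le summable_add)

lemma coeff_sum_add [simp]: "l1 f \<Longrightarrow> l1 g \<Longrightarrow> coeff_sum (f + g) = coeff_sum f + coeff_sum g"
  using suminf_add[OF l1_summable l1_summable, of f g] by (simp add: coeff_sum_def)

lemma l1_mult [simp]:
  assumes "l1 f" "l1 g" shows "l1 (f * g)"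
proof -
  have "summable (\<lambda>k. \<Sum>i\<le>k. \<bar>fps_nth f i\<bar> * \<bar>fps_nth g (k - i)\<bar>)"
    using summable_Cauchy_product[of "\<lambda>n. \<bar>fps_nth f n\<bar>" "\<lambda>n. \<bar>fps_nth g n\<bar>"] assms
    by (simp add: l1_def)
  thus ?thesis unfolding l1_def
    by (rule summable_comparison_test'[where N = 0])
      (auto simp: fps_mult_nth atLeast0AtMost abs_mult[symmetric] intro: sum_abs)
qed

lemma l1norm_mult:
  assumes "l1 f" "l1 g" shows "l1norm (f * g) \<le> l1norm f * l1norm g"
proof -
  have s: "(\<lambda>k. \<Sum>i\<le>k. \<bar>fps_nth f i\<bar> * \<bar>fps_nth g (k - i)\<bar>) sums (l1norm f * l1norm g)"
    using Cauchy_product_sums[of "\<lambda>n. \<bar>fps_nth f n\<bar>" "\<lambda>n. \<bar>fps_nth g n\<bar>"] assms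
    by (simp add: l1_def l1norm_def)
  have "l1norm (f * g) \<le> (\<Sum>k. \<Sum>i\<le>k. \<bar>fps_nth f i\<bar> * \<bar>fps_nth g (k - i)\<bar>)"
    unfolding l1norm_def
    using l1_mult[OF assms] sums_summable[OF s]
    by (intro suminf_le) (auto simp: l1_def fps_mult_nth atLeast0AtMost abs_mult[symmetric] intro: sum_abs)
  thus ?thesis using sums_unique[OF s] by simp
qed

lemma coeff_sum_mult [simp]:
  assumes "l1 f" "l1 g" shows "coeff_sum (f * g) = coeff_sum f * coeff_sum g"
  using Cauchy_product_sums[of "fps_nth f" "fps_nth g"] assms
  by (simp add: l1_def coeff_sum_def fps_mult_nth atLeast0AtMost sums_iff)

lemma l1_uminus [simp]: "l1 f \<Longrightarrow> l1 (- f)" "l1norm (- f) = l1norm f" "l1 f \<Longrightarrow> coeff_sum (- f) = - coeff_sum f"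
  by (auto simp: l1_def l1norm_def coeff_sum_def suminf_minus l1_summable[unfolded l1_def])

lemma l1_diff [simp]: "l1 f \<Longrightarrow> l1 g \<Longrightarrow> l1 (f - g)"
  using l1_add[of f "- g"] by simp

lemma l1norm_diff: "l1 f \<Longrightarrow> l1 g \<Longrightarrow> l1norm (f - g) \<le> l1norm f + l1norm g"
  using l1norm_add[of f "- g"] by simp

lemma coeff_sum_diff [simp]: "l1 f \<Longrightarrow> l1 g \<Longrightarrow> coeff_sum (f - g) = coeff_sum f - coeff_sum g"
  using coeff_sum_add[of f "- g"] by simp

lemma l1_power [simp]: "l1 f \<Longrightarrow> l1 (f ^ n)"
  by (induction n) auto

lemma coeff_sum_power [simp]: "l1 f \<Longrightarrow> coeff_sum (f ^ n) = coeff_sum f ^ n"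
  by (induction n) auto

lemma l1_sum [simp]: "(\<And>i. i \<in> I \<Longrightarrow> l1 (f i)) \<Longrightarrow> l1 (sum f I)"
  by (induction I rule: infinite_finite_induct) auto

lemma coeff_sum_sum: "(\<And>i. i \<in> I \<Longrightarrow> l1 (f i)) \<Longrightarrow> coeff_sum (sum f I) = (\<Sum>i\<in>I. coeff_sum (f i))"
  by (induction I rule: infinite_finite_induct) auto

lemma l1norm_sum: "(\<And>i. i \<in> I \<Longrightarrow> l1 (f i)) \<Longrightarrow> l1norm (sum f I) \<le> (\<Sum>i\<in>I. l1norm (f i))"
proof (induction I rule: infinite_finite_induct)
  case (insert x I)
  have "l1norm (f x + sum f I) \<le> l1norm (f x) + l1norm (sum f I)"
    by (rule l1norm_add) (use insert in auto)
  with insert show ?case by simp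
qed auto

lemma l1_prod [simp]: "(\<And>i. i \<in> I \<Longrightarrow> l1 (f i)) \<Longrightarrow> l1 (prod f I)"
  by (induction I rule: infinite_finite_induct) auto

lemma coeff_sum_prod: "(\<And>i. i \<in> I \<Longrightarrow> l1 (f i)) \<Longrightarrow> coeff_sum (prod f I) = (\<Prod>i\<in>I. coeff_sum (f i))"
  by (induction I rule: infinite_finite_induct) auto

lemma l1norm_const_mult: "l1 f \<Longrightarrow> l1norm (fps_const c * f) = \<bar>c\<bar> * l1norm f"
  unfolding l1_def l1norm_def by (simp add: abs_mult suminf_mult)

lemma l1norm_eq_coeff_sum: "(\<And>n. 0 \<le> fps_nth f n) \<Longrightarrow> l1norm f = coeff_sum f"
  by (simp add: l1norm_def coeff_sum_def)

lemma fps_mult_nonneg: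
  fixes f g :: "real fps"
  shows "(\<And>n. 0 \<le> fps_nth f n) \<Longrightarrow> (\<And>n. 0 \<le> fps_nth g n) \<Longrightarrow> 0 \<le> fps_nth (f * g) n"
  by (auto simp: fps_mult_nth intro: sum_nonneg)

lemma fps_prod_nonneg:
  fixes f :: "'a \<Rightarrow> real fps"
  shows "(\<And>i n. i \<in> I \<Longrightarrow> 0 \<le> fps_nth (f i) n) \<Longrightarrow> 0 \<le> fps_nth (prod f I) n"
proof (induction I arbitrary: n rule: infinite_finite_induct)
  case (insert x I)
  then show ?case by (auto intro!: fps_mult_nonneg)
qed auto

lemma l1_deriv_imp_l1: "l1 (fps_deriv f) \<Longrightarrow> l1 f"
proof -
  assume "l1 (fps_deriv f)"
  hence "summable (\<lambda>n. \<bar>real (n+1) * fps_nth f (n+1)\<bar>)" by (simp add: l1_def)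
  hence "summable (\<lambda>n. \<bar>fps_nth f (Suc n)\<bar>)"
  proof (rule summable_comparison_test'[where N = 0])
    fix n :: nat
    have "1 * \<bar>fps_nth f (Suc n)\<bar> \<le> (1 + real n) * \<bar>fps_nth f (Suc n)\<bar>" by (rule mult_right_mono) auto
    thus "norm \<bar>fps_nth f (Suc n)\<bar> \<le> \<bar>real (n+1) * fps_nth f (n+1)\<bar>" by (simp add: abs_mult)
  qed
  thus "l1 f" unfolding l1_def by (subst (asm) summable_Suc_iff)
qed

lemma fps_const_X_nth: "fps_nth ((1 - fps_const q * fps_X) * f) n =
   fps_nth f n - q * (if n = 0 then 0 else fps_nth f (n - 1))" for q :: real
  by (simp add: algebra_simps)

lemma one_minus_X_nth: "fps_nth ((1 - fps_X) * f) n =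
   fps_nth f n - (if n = 0 then 0 else fps_nth f (n - 1))" for f :: "real fps"
  by (simp add: algebra_simps)

lemma l1norm_one_minus_X: "l1norm (1 - fps_X) \<le> 2"
  using l1norm_diff[of 1 fps_X] by simp

lemma l1_one_minus_X [simp]: "l1 (1 - fps_X)" "coeff_sum (1 - fps_X) = 0"
  by simp_all

text \<open>The shift by one matches the argument of the upward term in a birth-death Stein operator.\<close>

definition pairing :: "real fps \<Rightarrow> (nat \<Rightarrow> real) \<Rightarrow> real" where
  "pairing f g = (\<Sum>m. fps_nth f m * g (m + 1))"

section \<open>Pairing summable series with bounded test functions\<close>

lemma summable_l1_bounded:
  assumes "l1 f" "\<And>m. \<bar>g m\<bar> \<le> C"
  shows "summable (\<lambda>m. fps_nth f m * g m)"
proof (rule summable_comparison_test'[where N = 0])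
  show "summable (\<lambda>m. \<bar>fps_nth f m\<bar> * C)" using assms(1) unfolding l1_def by (rule summable_mult2)
  show "norm (fps_nth f m * g m) \<le> \<bar>fps_nth f m\<bar> * C" for m
    using mult_left_mono[OF assms(2)[of m], of "\<bar>fps_nth f m\<bar>"] by (simp add: abs_mult)
qed

lemma suminf_l1_bounded:
  assumes "l1 f" "\<And>m. \<bar>g m\<bar> \<le> C"
  shows "\<bar>\<Sum>m. fps_nth f m * g m\<bar> \<le> l1norm f * C"
proof -
  have s: "summable (\<lambda>m. \<bar>fps_nth f m\<bar> * C)" using assms(1) unfolding l1_def by (rule summable_mult2)
  have b: "\<bar>fps_nth f m * g m\<bar> \<le> \<bar>fps_nth f m\<bar> * C" for m
    using mult_left_mono[OF assms(2)[of m], of "\<bar>fps_nth f m\<bar>"] by (simp add: abs_mult)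
  have s2: "summable (\<lambda>m. \<bar>fps_nth f m * g m\<bar>)"
    by (rule summable_comparison_test'[OF s, where N = 0]) (use b in auto)
  have "\<bar>\<Sum>m. fps_nth f m * g m\<bar> \<le> (\<Sum>m. \<bar>fps_nth f m * g m\<bar>)" by (rule summable_rabs[OF s2])
  also have "\<dots> \<le> (\<Sum>m. \<bar>fps_nth f m\<bar> * C)" by (rule suminf_le[OF b s2 s])
  also have "\<dots> = l1norm f * C"
    using assms(1) unfolding l1_def l1norm_def by (simp add: suminf_mult2)
  finally show ?thesis .
qed

lemma pairing_diff:
  assumes "l1 f" "l1 h" "\<And>m. \<bar>g m\<bar> \<le> C"
  shows "pairing (f - h) g = pairing f g - pairing h g"
  unfolding pairing_def
  using summable_l1_bounded[of f "\<lambda>m. g (m+1)", OF assms(1)] summable_l1_bounded[of h "\<lambda>m. g (m+1)", OF assms(2)] assms(3)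
  by (subst suminf_diff) (auto simp: algebra_simps)

lemma pairing_const_mult:
  assumes "l1 f" "\<And>m. \<bar>g m\<bar> \<le> C"
  shows "pairing (fps_const c * f) g = c * pairing f g"
  unfolding pairing_def
  using summable_l1_bounded[of f "\<lambda>m. g (m+1)", OF assms(1)] assms(2)
  by (subst suminf_mult[symmetric]) (auto simp: algebra_simps)

lemma pairing_X_mult:
  assumes "l1 f" "\<And>m. \<bar>g m\<bar> \<le> C"
  shows "pairing (fps_X * f) g = (\<Sum>m. fps_nth f m * g (m + 2))"
proof -
  have "summable (\<lambda>m. fps_nth (fps_X * f) m * g (m + 1))"
    by (rule summable_l1_bounded) (use assms in auto)
  from suminf_split_head[OF this] show ?thesis unfolding pairing_def by simp
qed

text \<open>Abel summation: the factor 1 - X moves onto \<open>g\<close> as a difference. Since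
  \<open>pairing\<close> reads \<open>g\<close> from 1 on, only increments at m >= 1 occur.\<close>

lemma pairing_one_minus_X:
  assumes "l1 f" "\<And>m. \<bar>g m\<bar> \<le> C" "\<And>m. m \<ge> 1 \<Longrightarrow> \<bar>g (m + 1) - g m\<bar> \<le> B"
  shows "\<bar>pairing ((1 - fps_X) * f) g\<bar> \<le> l1norm f * B"
proof -
  have "pairing ((1 - fps_X) * f) g = pairing f g - pairing (fps_X * f) g"
    using pairing_diff[of f "fps_X * f" g C] assms by (simp add: algebra_simps)
  also have "\<dots> = (\<Sum>m. fps_nth f m * (g (m+1) - g (m+2)))"
    unfolding pairing_X_mult[OF assms(1,2)] unfolding pairing_def
    using summable_l1_bounded[of f "\<lambda>m. g (m+1)", OF assms(1)] summable_l1_bounded[of f "\<lambda>m. g (m+2)", OF assms(1)] assms(2)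
    by (subst suminf_diff) (auto simp: algebra_simps)
  also have "\<bar>\<dots>\<bar> \<le> l1norm f * B"
    by (rule suminf_l1_bounded[OF assms(1)]) (use assms(3)[of "_ + 1"] in \<open>simp add: abs_minus_commute add.commute\<close>)
  finally show ?thesis .
qed

text \<open>The coefficients of X P' are m P_m, so P' paired with \<open>g\<close> gives the death
  term m g(m) after an index shift, and X P' gives m g(m+1). The differential equation replaces (1 -
  q X) P' by P E, which removes the unbounded factor m.\<close>

lemma stein_identity:
  assumes P: "l1 P" "l1 (fps_deriv P)" and E: "l1 E"
    and ode: "(1 - fps_const q * fps_X) * fps_deriv P = P * E"
    and g: "\<And>m. \<bar>g m\<bar> \<le> C"
  shows "(\<Sum>m. fps_nth P m * (q * (r + real m) * g (m+1) - real m * g m)) =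
           pairing (P * (fps_const (r * q) - E)) g"
proof -
  let ?D = "fps_deriv P"
  have XD: "fps_nth (fps_X * ?D) m = real m * fps_nth P m" for m by (cases m) auto
  have s1: "summable (\<lambda>m. real m * fps_nth P m * g (m+1))"
    using summable_l1_bounded[of "fps_X * ?D" "\<lambda>m. g (m+1)" C] P g by (simp del: fps_X_mult_nth add: XD)
  have s0: "summable (\<lambda>m. real m * fps_nth P m * g m)"
    using summable_l1_bounded[of "fps_X * ?D" "\<lambda>m. g m" C] P g by (simp del: fps_X_mult_nth add: XD)
  have s2: "summable (\<lambda>m. fps_nth P m * g (m+1))"
    by (rule summable_l1_bounded) (use P g in auto)
  have "pairing ?D g = (\<Sum>m. real m * fps_nth P m * g m)"
    using suminf_split_head[OF s0] by (simp add: pairing_def algebra_simps)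
  moreover have "pairing (fps_X * ?D) g = (\<Sum>m. real m * fps_nth P m * g (m+1))"
    unfolding pairing_def XD ..
  moreover have "pairing (P * E) g = pairing ?D g - q * pairing (fps_X * ?D) g"
  proof -
    have "P * E = ?D - fps_const q * (fps_X * ?D)" using ode by (simp add: algebra_simps)
    thus ?thesis using P g by (simp add: pairing_diff[where C = C] pairing_const_mult[where C = C])
  qed
  moreover have "pairing (P * (fps_const (r * q) - E)) g = (r * q) * pairing P g - pairing (P * E) g"
  proof -
    have "P * (fps_const (r * q) - E) = fps_const (r * q) * P - P * E" by (simp add: algebra_simps)
    thus ?thesis using P E g by (simp add: pairing_diff[where C = C] pairing_const_mult[where C = C])
  qed
  moreover have "(\<Sum>m. fps_nth P m * (q * (r + real m) * g (m+1) - real m * g m)) =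
     (r * q) * pairing P g + q * (\<Sum>m. real m * fps_nth P m * g (m+1)) - (\<Sum>m. real m * fps_nth P m * g m)"
  proof -
    have "(\<lambda>m. (r * q) * (fps_nth P m * g (m+1)) + q * (real m * fps_nth P m * g (m+1)) - real m * fps_nth P m * g m)
       sums ((r * q) * pairing P g + q * (\<Sum>m. real m * fps_nth P m * g (m+1)) - (\<Sum>m. real m * fps_nth P m * g m))"
      unfolding pairing_def by (intro sums_add sums_diff sums_mult summable_sums s0 s1 s2)
    thus ?thesis by (simp add: sums_iff algebra_simps)
  qed
  ultimately show ?thesis by simp
qed

section \<open>Dividing by powers of one minus X\<close>

text \<open>The quotient has the partial sums of \<open>c\<close> as coefficients. As the total is
  0, these are negated tails, and exchanging summations turns a weight \<open>v\<close> on the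
  quotient into its cumulative sum on \<open>c\<close>. Allowing arbitrary weights makes the
  division repeatable.\<close>

lemma factor_one_minus_X:
  assumes c: "l1 c" "coeff_sum c = 0"
  obtains C where "c = (1 - fps_X) * C"
    and "\<And>v :: nat \<Rightarrow> real. (\<And>k. 0 \<le> v k) \<Longrightarrow> summable (\<lambda>l. (\<Sum>k<l. v k) * \<bar>fps_nth c l\<bar>) \<Longrightarrow>
           summable (\<lambda>j. v j * \<bar>fps_nth C j\<bar>) \<and>
           (\<Sum>j. v j * \<bar>fps_nth C j\<bar>) \<le> (\<Sum>l. (\<Sum>k<l. v k) * \<bar>fps_nth c l\<bar>)"
proof
  let ?C = "Abs_fps (\<lambda>j. \<Sum>l\<le>j. fps_nth c l)"
  show "c = (1 - fps_X) * ?C"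
  proof (rule fps_ext)
    fix n show "fps_nth c n = fps_nth ((1 - fps_X) * ?C) n"
      by (cases n) (simp_all add: one_minus_X_nth)
  qed
  fix v :: "nat \<Rightarrow> real"
  assume v: "\<And>k. 0 \<le> v k" and s: "summable (\<lambda>l. (\<Sum>k<l. v k) * \<bar>fps_nth c l\<bar>)"
  let ?S = "\<Sum>l. (\<Sum>k<l. v k) * \<bar>fps_nth c l\<bar>"
  have sc: "summable (\<lambda>l. \<bar>fps_nth c l\<bar>)" using c by (simp add: l1_def)
  have sm: "summable (\<lambda>l. if j < l then \<bar>fps_nth c l\<bar> else 0)" for j
    by (rule summable_comparison_test'[OF sc, where N = 0]) auto
  have C: "\<bar>fps_nth ?C j\<bar> \<le> (\<Sum>l. if j < l then \<bar>fps_nth c l\<bar> else 0)" for j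
  proof -
    have "0 = (\<Sum>l. fps_nth c (l + Suc j)) + (\<Sum>l<Suc j. fps_nth c l)"
      using c suminf_split_initial_segment[OF l1_summable[OF c(1)], of "Suc j"] by (simp add: coeff_sum_def)
    hence "\<bar>fps_nth ?C j\<bar> = \<bar>\<Sum>l. fps_nth c (l + Suc j)\<bar>" by (simp add: lessThan_Suc_atMost)
    also have "\<dots> \<le> (\<Sum>l. \<bar>fps_nth c (l + Suc j)\<bar>)"
      by (rule summable_rabs) (use sc summable_iff_shift[of "\<lambda>l. \<bar>fps_nth c l\<bar>" "Suc j"] in simp)
    also have "\<dots> = (\<Sum>l. if j < l then \<bar>fps_nth c l\<bar> else 0)"
      using suminf_split_initial_segment[OF sm, of j "Suc j"] by simp
    finally show ?thesis .
  qed
  have part: "(\<Sum>j<N. v j * \<bar>fps_nth ?C j\<bar>) \<le> ?S" for N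
  proof -
    have "(\<Sum>j<N. v j * \<bar>fps_nth ?C j\<bar>) \<le> (\<Sum>j<N. v j * (\<Sum>l. if j < l then \<bar>fps_nth c l\<bar> else 0))"
      by (intro sum_mono mult_left_mono C v)
    also have "\<dots> = (\<Sum>j<N. \<Sum>l. v j * (if j < l then \<bar>fps_nth c l\<bar> else 0))"
      by (intro sum.cong refl suminf_mult[symmetric] sm)
    also have "\<dots> = (\<Sum>l. \<Sum>j<N. v j * (if j < l then \<bar>fps_nth c l\<bar> else 0))"
      by (intro suminf_sum[symmetric] summable_mult sm)
    also have "\<dots> \<le> ?S"
    proof (rule suminf_le[OF _ _ s])
      fix l
      have "(\<Sum>j<N. v j * (if j < l then \<bar>fps_nth c l\<bar> else 0)) = (\<Sum>j\<in>{..<N} \<inter> {..<l}. v j * \<bar>fps_nth c l\<bar>)"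
        by (intro sum.mono_neutral_cong_right) auto
      also have "\<dots> \<le> (\<Sum>j<l. v j * \<bar>fps_nth c l\<bar>)"
        by (rule sum_mono2) (auto simp: v)
      finally show "(\<Sum>j<N. v j * (if j < l then \<bar>fps_nth c l\<bar> else 0)) \<le> (\<Sum>k<l. v k) * \<bar>fps_nth c l\<bar>"
        by (simp add: sum_distrib_right)
    qed (intro summable_sum summable_mult sm)
    finally show ?thesis .
  qed
  have "summable (\<lambda>j. v j * \<bar>fps_nth ?C j\<bar>)"
    by (rule bounded_imp_summable[where B = ?S])
      (use v part[of "Suc _"] in \<open>auto simp: lessThan_Suc_atMost simp del: sum.lessThan_Suc\<close>)
  moreover from this have "(\<Sum>j. v j * \<bar>fps_nth ?C j\<bar>) \<le> ?S"
    by (rule suminf_le_const) (rule part)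
  ultimately show "summable (\<lambda>j. v j * \<bar>fps_nth ?C j\<bar>) \<and> (\<Sum>j. v j * \<bar>fps_nth ?C j\<bar>) \<le> ?S" ..
qed

lemma l1_deriv_sums:
  assumes "l1 (fps_deriv f)"
  shows "summable (\<lambda>l. real l * \<bar>fps_nth f l\<bar>)" "(\<Sum>l. real l * \<bar>fps_nth f l\<bar>) = l1norm (fps_deriv f)"
proof -
  have "(\<lambda>l. real (Suc l) * \<bar>fps_nth f (Suc l)\<bar>) sums l1norm (fps_deriv f)"
    using assms unfolding l1_def l1norm_def sums_iff by (simp add: abs_mult)
  hence "(\<lambda>l. real l * \<bar>fps_nth f l\<bar>) sums l1norm (fps_deriv f)" by (subst (asm) sums_Suc_iff) simp
  thus "summable (\<lambda>l. real l * \<bar>fps_nth f l\<bar>)" "(\<Sum>l. real l * \<bar>fps_nth f l\<bar>) = l1norm (fps_deriv f)"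
    by (auto simp: sums_iff)
qed

lemma sums_Suc_Suc_iff:
  fixes f :: "nat \<Rightarrow> real"
  assumes "f 0 = 0" "f 1 = 0"
  shows "(\<lambda>l. f (Suc (Suc l))) sums s \<longleftrightarrow> f sums s"
  using assms sums_Suc_iff[of "\<lambda>l. f (Suc l)" s] sums_Suc_iff[of f s] by simp

text \<open>Sums with binomial weights are norms of derivatives divided by a factorial: 2 here, 6
  for the third derivative. The coefficients lost by differentiation carry weight 0.\<close>

lemma l1_deriv2_sums:
  "(\<lambda>l. real (l choose 2) * \<bar>fps_nth f l\<bar>) sums s \<longleftrightarrow> (\<lambda>n. \<bar>fps_nth (fps_deriv (fps_deriv f)) n\<bar>) sums (2 * s)"
proof -
  have ch: "2 * real (Suc (Suc n) choose 2) = real (n + 1) * real (n + 2)" for n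
    using Suc_times_binomial[of 1 "Suc n"]
    by (simp add: numeral_2_eq_2 del: binomial_Suc_Suc of_nat_Suc flip: of_nat_mult)
  have "(\<lambda>l. real (l choose 2) * \<bar>fps_nth f l\<bar>) sums s \<longleftrightarrow>
     (\<lambda>n. real (Suc (Suc n) choose 2) * \<bar>fps_nth f (Suc (Suc n))\<bar>) sums s"
    using sums_Suc_Suc_iff[of "\<lambda>l. real (l choose 2) * \<bar>fps_nth f l\<bar>"] by simp
  also have "\<dots> \<longleftrightarrow> (\<lambda>n. 2 * (real (Suc (Suc n) choose 2) * \<bar>fps_nth f (Suc (Suc n))\<bar>)) sums (2 * s)"
    by (rule sums_mult_iff[symmetric]) simp
  also have "(\<lambda>n. 2 * (real (Suc (Suc n) choose 2) * \<bar>fps_nth f (Suc (Suc n))\<bar>)) = (\<lambda>n. \<bar>fps_nth (fps_deriv (fps_deriv f)) n\<bar>)"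
    unfolding mult.assoc[symmetric] ch by (auto simp: abs_mult mult_ac add_ac)
  finally show ?thesis .
qed

lemma l1_deriv3_sums:
  "(\<lambda>l. real (l choose 3) * \<bar>fps_nth f l\<bar>) sums s \<longleftrightarrow>
     (\<lambda>n. \<bar>fps_nth (fps_deriv (fps_deriv (fps_deriv f))) n\<bar>) sums (6 * s)"
proof -
  have ch: "3 * real (Suc n choose 3) = real (n + 1) * real (n choose 2)" for n
    using Suc_times_binomial[of 2 n] by (simp add: numeral_3_eq_3 numeral_2_eq_2 del: binomial_Suc_Suc of_nat_Suc flip: of_nat_mult)
  have "(\<lambda>l. real (l choose 3) * \<bar>fps_nth f l\<bar>) sums s \<longleftrightarrow>
     (\<lambda>l. 3 * (real (l choose 3) * \<bar>fps_nth f l\<bar>)) sums (3 * s)"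
    by (rule sums_mult_iff[symmetric]) simp
  also have "\<dots> \<longleftrightarrow> (\<lambda>l. 3 * (real (Suc l choose 3) * \<bar>fps_nth f (Suc l)\<bar>)) sums (3 * s)"
    using sums_Suc_iff[of "\<lambda>l. 3 * (real (l choose 3) * \<bar>fps_nth f l\<bar>)" "3 * s"]
    by (simp add: binomial_eq_0)
  also have "(\<lambda>l. 3 * (real (Suc l choose 3) * \<bar>fps_nth f (Suc l)\<bar>)) = (\<lambda>l. real (l choose 2) * \<bar>fps_nth (fps_deriv f) l\<bar>)"
    unfolding mult.assoc[symmetric] ch by (auto simp: abs_mult mult_ac)
  also have "\<dots> sums (3 * s) \<longleftrightarrow> (\<lambda>n. \<bar>fps_nth (fps_deriv (fps_deriv (fps_deriv f))) n\<bar>) sums (2 * (3 * s))"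
    by (rule l1_deriv2_sums)
  finally show ?thesis by simp
qed

lemma sum_choose_lessThan: "(\<Sum>k<l. real (k choose m)) = real (l choose Suc m)"
proof (cases l)
  case (Suc n)
  have "(\<Sum>k<Suc n. k choose m) = Suc n choose Suc m"
    unfolding lessThan_Suc_atMost by (rule sum_choose_upper)
  thus ?thesis unfolding Suc by (metis of_nat_sum)
qed simp

lemma factor_one_minus_X_once:
  assumes c: "l1 (fps_deriv c)" "coeff_sum c = 0"
  obtains C where "c = (1 - fps_X) * C" "l1 C" "l1norm C \<le> l1norm (fps_deriv c)"
proof -
  obtain C where C: "c = (1 - fps_X) * C"
    and w: "\<And>v :: nat \<Rightarrow> real. (\<And>k. 0 \<le> v k) \<Longrightarrow> summable (\<lambda>l. (\<Sum>k<l. v k) * \<bar>fps_nth c l\<bar>) \<Longrightarrow>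
           summable (\<lambda>j. v j * \<bar>fps_nth C j\<bar>) \<and>
           (\<Sum>j. v j * \<bar>fps_nth C j\<bar>) \<le> (\<Sum>l. (\<Sum>k<l. v k) * \<bar>fps_nth c l\<bar>)"
    by (rule factor_one_minus_X[OF l1_deriv_imp_l1[OF c(1)] c(2)]) blast
  show thesis
    by (rule that[OF C]) (use w[of "\<lambda>_. 1"] l1_deriv_sums[OF c(1)] in \<open>auto simp: l1_def l1norm_def\<close>)
qed

text \<open>By the hockey-stick identity each division lowers the binomial weight by one order, so
  the weight l choose 3 on \<open>c\<close> ends as weight 1 on \<open>C\<close>; the 6 is 3!.
  Evaluating derivatives of each factorisation at 1 passes the vanishing conditions on to the next
  quotient.\<close>

lemma factor_one_minus_X_cubed:
  assumes c: "l1 (fps_deriv (fps_deriv (fps_deriv c)))"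
    and t: "coeff_sum c = 0" "coeff_sum (fps_deriv c) = 0" "coeff_sum (fps_deriv (fps_deriv c)) = 0"
  obtains C where "c = (1 - fps_X) ^ 3 * C" "l1 C" "6 * l1norm C \<le> l1norm (fps_deriv (fps_deriv (fps_deriv c)))"
proof -
  let ?N = "l1norm (fps_deriv (fps_deriv (fps_deriv c)))"
  have c2: "l1 (fps_deriv (fps_deriv c))" and c1: "l1 (fps_deriv c)" and c0: "l1 c"
    using c l1_deriv_imp_l1 by blast+
  obtain C1 where C1: "c = (1 - fps_X) * C1"
    and w1: "\<And>v :: nat \<Rightarrow> real. (\<And>k. 0 \<le> v k) \<Longrightarrow> summable (\<lambda>l. (\<Sum>k<l. v k) * \<bar>fps_nth c l\<bar>) \<Longrightarrow>
           summable (\<lambda>j. v j * \<bar>fps_nth C1 j\<bar>) \<and>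
           (\<Sum>j. v j * \<bar>fps_nth C1 j\<bar>) \<le> (\<Sum>l. (\<Sum>k<l. v k) * \<bar>fps_nth c l\<bar>)"
    by (rule factor_one_minus_X[OF c0 t(1)]) blast
  have "(\<lambda>l. real (l choose 3) * \<bar>fps_nth c l\<bar>) sums (?N / 6)"
    unfolding l1_deriv3_sums using c by (simp add: l1_def l1norm_def sums_iff)
  hence s3: "(\<lambda>l. (\<Sum>k<l. real (k choose 2)) * \<bar>fps_nth c l\<bar>) sums (?N / 6)"
    by (simp add: sum_choose_lessThan)
  have S1: "summable (\<lambda>l. real (l choose 2) * \<bar>fps_nth C1 l\<bar>)" "(\<Sum>l. real (l choose 2) * \<bar>fps_nth C1 l\<bar>) \<le> ?N / 6"
    using w1[of "\<lambda>l. real (l choose 2)"] s3 by (auto simp: sums_iff)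
  have C1'': "l1 (fps_deriv (fps_deriv C1))"
    using summable_sums[OF S1(1)] unfolding l1_deriv2_sums l1_def by (rule sums_summable)
  have C1': "l1 (fps_deriv C1)" and C10: "l1 C1" using C1'' l1_deriv_imp_l1 by blast+
  have d1: "fps_deriv c = (1 - fps_X) * fps_deriv C1 - C1"
    by (simp add: C1 algebra_simps)
  have t1: "coeff_sum C1 = 0" using t(2) C1' C10 by (simp add: d1)
  have "fps_deriv (fps_deriv c) = (1 - fps_X) * fps_deriv (fps_deriv C1) - fps_const 2 * fps_deriv C1"
    unfolding d1 by (simp add: algebra_simps flip: numeral_fps_const)
  hence t1': "coeff_sum (fps_deriv C1) = 0" using t(3) C1'' C1' by simp
  obtain C2 where C2: "C1 = (1 - fps_X) * C2"
    and w2: "\<And>v :: nat \<Rightarrow> real. (\<And>k. 0 \<le> v k) \<Longrightarrow> summable (\<lambda>l. (\<Sum>k<l. v k) * \<bar>fps_nth C1 l\<bar>) \<Longrightarrow>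
           summable (\<lambda>j. v j * \<bar>fps_nth C2 j\<bar>) \<and>
           (\<Sum>j. v j * \<bar>fps_nth C2 j\<bar>) \<le> (\<Sum>l. (\<Sum>k<l. v k) * \<bar>fps_nth C1 l\<bar>)"
    by (rule factor_one_minus_X[OF C10 t1]) blast
  have S2: "summable (\<lambda>l. real l * \<bar>fps_nth C2 l\<bar>)" "(\<Sum>l. real l * \<bar>fps_nth C2 l\<bar>) \<le> ?N / 6"
    using w2[of "\<lambda>l. real l"] S1 sum_choose_lessThan[of 1] by (auto simp: numeral_2_eq_2)
  have "summable (\<lambda>l. \<bar>fps_nth (fps_deriv C2) l\<bar>)"
    using S2(1) by (subst (asm) summable_Suc_iff[symmetric]) (simp add: abs_mult)
  hence C2': "l1 (fps_deriv C2)" by (simp add: l1_def)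
  have "fps_deriv C1 = (1 - fps_X) * fps_deriv C2 - C2" by (simp add: C2 algebra_simps)
  hence t2: "coeff_sum C2 = 0" using t1' C2' l1_deriv_imp_l1[OF C2'] by simp
  obtain C where C: "C2 = (1 - fps_X) * C" "l1 C" "l1norm C \<le> l1norm (fps_deriv C2)"
    using factor_one_minus_X_once[OF C2' t2] by blast
  show thesis
  proof (rule that[OF _ C(2)])
    show "c = (1 - fps_X) ^ 3 * C" by (simp add: C1 C2 C(1) power3_eq_cube mult.assoc)
    show "6 * l1norm C \<le> ?N" using C(3) l1_deriv_sums(2)[OF C2'] S2(2) by simp
  qed
qed

section \<open>Geometric series\<close>

definition geo_fps :: "real \<Rightarrow> real fps" where
  "geo_fps q = Abs_fps (\<lambda>n. q ^ n)"

lemma geo_fps_inverse: "(1 - fps_const q * fps_X) * geo_fps q = 1"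
proof (rule fps_ext)
  fix n show "fps_nth ((1 - fps_const q * fps_X) * geo_fps q) n = fps_nth 1 n"
    unfolding fps_const_X_nth by (cases n) (auto simp: geo_fps_def)
qed

lemma geo_fps_deriv: "fps_deriv (geo_fps q) = fps_const q * geo_fps q ^ 2"
proof -
  have "fps_deriv ((1 - fps_const q * fps_X) * geo_fps q) = 0" by (simp add: geo_fps_inverse)
  hence "(1 - fps_const q * fps_X) * fps_deriv (geo_fps q) = fps_const q * geo_fps q"
    by (simp add: algebra_simps)
  hence "geo_fps q * ((1 - fps_const q * fps_X) * fps_deriv (geo_fps q)) = geo_fps q * (fps_const q * geo_fps q)"
    by simp
  hence "((1 - fps_const q * fps_X) * geo_fps q) * fps_deriv (geo_fps q) = fps_const q * geo_fps q ^ 2"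
    by (simp only: power2_eq_square mult_ac)
  thus ?thesis by (simp add: geo_fps_inverse)
qed

context
  fixes q :: real
  assumes q: "0 \<le> q" "q < 1"
begin

lemma geo_fps_l1 [simp]: "l1 (geo_fps q)" "coeff_sum (geo_fps q) = 1 / (1 - q)"
  using q by (auto simp: l1_def coeff_sum_def geo_fps_def suminf_geometric)

lemma l1norm_geo_power: "l1norm (geo_fps q ^ k) = (1 / (1 - q)) ^ k"
proof -
  have "0 \<le> fps_nth (geo_fps q ^ k) n" for n
    by (induction k arbitrary: n) (auto intro!: fps_mult_nonneg simp: geo_fps_def q)
  thus ?thesis by (simp add: l1norm_eq_coeff_sum)
qed

text \<open>Writing 1 - X as (1 - q X) - (1 - q) X gives a bound uniform in \<open>q\<close>;
  submultiplicativity alone would give 2 / (1 - q).\<close>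

lemma l1norm_one_minus_X_geo: "l1norm ((1 - fps_X) * geo_fps q) \<le> 2"
proof -
  have *: "(1 - fps_X) = (1 - fps_const q * fps_X) - fps_const (1 - q) * fps_X"
    by (simp add: algebra_simps flip: fps_const_sub)
  have "(1 - fps_X) * geo_fps q = (1 - fps_const q * fps_X) * geo_fps q - fps_const (1 - q) * (fps_X * geo_fps q)"
    unfolding * left_diff_distrib by (simp only: mult.assoc)
  hence "l1norm ((1 - fps_X) * geo_fps q) \<le> 1 + l1norm (fps_const (1 - q) * (fps_X * geo_fps q))"
    using l1norm_diff[of 1 "fps_const (1 - q) * (fps_X * geo_fps q)"] by (simp add: geo_fps_inverse)
  also have "\<dots> \<le> 1 + (1 - q) * (1 * (1 / (1 - q)))"
    using q l1norm_mult[of fps_X "geo_fps q"] l1norm_geo_power[of 1]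
    by (simp add: l1norm_const_mult del: mult_1) (simp add: field_simps)
  finally show ?thesis using q by simp
qed

end

section \<open>The Stein equation of the negative binomial law\<close>

definition nb_fps :: "real \<Rightarrow> real \<Rightarrow> real fps" where
  "nb_fps \<alpha> p = Abs_fps (nb_mass \<alpha> p)"

lemma nb_fps_nth [simp]: "fps_nth (nb_fps \<alpha> p) m = nb_mass \<alpha> p m"
  by (simp add: nb_fps_def)

lemma nb_mass_0: "nb_mass \<alpha> p 0 = p powr \<alpha>"
  by (simp add: nb_mass_def)

text \<open>Detailed balance for the birth-death chain with birth rates (1 - p) (\<alpha> + m) and
  death rates m; it is the absorption identity for binomial coefficients.\<close>

lemma nb_mass_Suc: "real (Suc m) * nb_mass \<alpha> p (Suc m) = (1 - p) * (\<alpha> + real m) * nb_mass \<alpha> p m"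
proof -
  have "real (Suc m) * ((\<alpha> + real (Suc m) - 1) gchoose Suc m) = (\<alpha> + real m) * ((\<alpha> + real m - 1) gchoose m)"
    using gbinomial_absorption[of m "\<alpha> + real m"] by simp
  hence "real (Suc m) * ((\<alpha> + real (Suc m) - 1) gchoose Suc m) * (p powr \<alpha> * (1 - p) ^ Suc m)
      = (\<alpha> + real m) * ((\<alpha> + real m - 1) gchoose m) * (p powr \<alpha> * (1 - p) ^ Suc m)" by simp
  thus ?thesis unfolding nb_mass_def power_Suc by (simp only: mult_ac)
qed

lemma geo_mass_eq_nb: "0 < p \<Longrightarrow> geo_mass p = nb_mass 1 p"
proof
  fix m assume p: "0 < p"
  have "(real m gchoose m) = 1" using binomial_gbinomial[of m m, where ?'a = real] by simp
  thus "geo_mass p m = nb_mass 1 p m" using p by (simp add: geo_mass_def nb_mass_def)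
qed

text \<open>The numerator \<open>?L\<close> is affine in s, t and \<phi>. By \<open>i\<close> and
  \<open>ii\<close> it decreases in s and t, and it increases in \<phi>, so its extremes are at s =
  t = 0, \<phi> = 1 and at s = F, t = G, \<phi> = 0. In the application F, \<pi>, G are the masses
  below, at and above a point, and b, d are the birth and death rates there.\<close>

lemma stein_kernel_bound:
  fixes s t \<phi> F G \<pi> b d :: real
  assumes s: "0 \<le> s" "s \<le> F" and t: "0 \<le> t" "t \<le> G" and \<phi>: "0 \<le> \<phi>" "\<phi> \<le> 1"
    and tot: "F + \<pi> + G = 1" and "0 < \<pi>" "0 < b" "0 < d"
    and i: "b * F \<le> d * (F + \<pi>)" and ii: "d * G \<le> b * (G + \<pi>)"
  defines "c \<equiv> s + \<pi> * \<phi> + t"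
  shows "\<bar>(s + \<pi> * \<phi> - (F + \<pi>) * c) / (b * \<pi>) - (s - F * c) / (d * \<pi>)\<bar> \<le> 1 / b"
proof -
  let ?L = "d * (s + \<pi> * \<phi> - (F + \<pi>) * c) - b * (s - F * c)"
  have G: "G = 1 - F - \<pi>" using tot by simp
  have L: "?L = s * (d * G - b * (G + \<pi>)) + \<phi> * (\<pi> * (d * G + b * F)) + t * (b * F - d * (F + \<pi>))"
    unfolding c_def G by (simp add: algebra_simps)
  have K: "d * G + b * F \<le> d"
  proof -
    have "d * G + b * F \<le> d * G + d * (F + \<pi>)" using i by simp
    also have "\<dots> = d" unfolding G by (simp add: algebra_simps)
    finally show ?thesis .
  qed
  have K0: "0 \<le> d * G + b * F" using assms by simp
  have u: "?L \<le> \<pi> * d"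
  proof -
    have "s * (d * G - b * (G + \<pi>)) \<le> 0" "t * (b * F - d * (F + \<pi>)) \<le> 0"
      using s t i ii by (auto intro!: mult_nonneg_nonpos)
    moreover have "\<phi> * (\<pi> * (d * G + b * F)) \<le> 1 * (\<pi> * d)"
      using \<phi> K K0 \<open>0 < \<pi>\<close> by (intro mult_mono) auto
    ultimately show ?thesis unfolding L by simp
  qed
  have l: "- (\<pi> * d) \<le> ?L"
  proof -
    have "F * (d * G - b * (G + \<pi>)) \<le> s * (d * G - b * (G + \<pi>))"
      "G * (b * F - d * (F + \<pi>)) \<le> t * (b * F - d * (F + \<pi>))"
      using s t i ii by (auto intro!: mult_right_mono_neg)
    moreover have "0 \<le> \<phi> * (\<pi> * (d * G + b * F))" using \<phi> K0 \<open>0 < \<pi>\<close> by simp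
    moreover have "F * (d * G - b * (G + \<pi>)) + G * (b * F - d * (F + \<pi>)) = - (\<pi> * (d * G + b * F))"
      by (simp add: algebra_simps)
    moreover have "\<pi> * (d * G + b * F) \<le> \<pi> * d" using K \<open>0 < \<pi>\<close> by simp
    ultimately show ?thesis unfolding L by linarith
  qed
  have "(s + \<pi> * \<phi> - (F + \<pi>) * c) / (b * \<pi>) - (s - F * c) / (d * \<pi>) = ?L / (b * (\<pi> * d))"
  proof -
    have "u / (b * \<pi>) - v / (d * \<pi>) = (d * u - b * v) / (b * (\<pi> * d))" for u v
      using \<open>0 < \<pi>\<close> \<open>0 < b\<close> \<open>0 < d\<close> by (simp add: field_simps)
    thus ?thesis .
  qed
  also have "\<bar>\<dots>\<bar> = \<bar>?L\<bar> / (b * (\<pi> * d))"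
    using \<open>0 < \<pi>\<close> \<open>0 < b\<close> \<open>0 < d\<close> by (simp add: abs_divide abs_mult)
  also have "\<dots> \<le> (\<pi> * d) / (b * (\<pi> * d))"
    using u l \<open>0 < \<pi>\<close> \<open>0 < b\<close> \<open>0 < d\<close> by (intro divide_right_mono) auto
  also have "\<dots> = 1 / b" using \<open>0 < \<pi>\<close> \<open>0 < d\<close> by simp
  finally show ?thesis .
qed

context
  fixes \<alpha> p :: real
  assumes \<alpha>: "0 < \<alpha>" and p: "0 < p" "p < 1"
begin

lemma nb_mass_pos: "0 < nb_mass \<alpha> p m"
proof (induction m)
  case (Suc m)
  have "0 < real (Suc m) * nb_mass \<alpha> p (Suc m)"
    unfolding nb_mass_Suc using Suc \<alpha> p by simp
  thus ?case by (simp add: zero_less_mult_iff)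
qed (use p in \<open>simp add: nb_mass_0\<close>)

lemma nb_mass_sums: "nb_mass \<alpha> p sums 1"
proof -
  have "(\<lambda>n. ((- \<alpha>) gchoose n) * (- (1 - p)) ^ n) sums (1 + (- (1 - p))) powr (- \<alpha>)"
    by (rule gen_binomial_real) (use p in auto)
  hence "(\<lambda>n. p powr \<alpha> * (((- \<alpha>) gchoose n) * (- (1 - p)) ^ n)) sums (p powr \<alpha> * p powr (- \<alpha>))"
    by (intro sums_mult) simp
  moreover have "p powr \<alpha> * (((- \<alpha>) gchoose n) * (- (1 - p)) ^ n) = nb_mass \<alpha> p n" for n
    unfolding gbinomial_minus power_minus[of "1 - p"] nb_mass_def by (simp add: mult_ac power_mult_distrib[symmetric])
  moreover have "p powr \<alpha> * p powr (- \<alpha>) = 1" using p by (simp add: powr_minus)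
  ultimately show ?thesis by (simp only:)
qed

lemma nb_fps_l1 [simp]: "l1 (nb_fps \<alpha> p)" "coeff_sum (nb_fps \<alpha> p) = 1"
  unfolding l1_def coeff_sum_def nb_fps_nth abs_of_pos[OF nb_mass_pos]
  using nb_mass_sums by (simp_all add: sums_iff)

lemma nb_fps_deriv: "fps_deriv (nb_fps \<alpha> p) = nb_fps \<alpha> p * (fps_const (\<alpha> * (1 - p)) * geo_fps (1 - p))"
proof -
  let ?N = "nb_fps \<alpha> p" and ?q = "1 - p"
  have ode: "(1 - fps_const ?q * fps_X) * fps_deriv ?N = fps_const (\<alpha> * ?q) * ?N"
  proof (rule fps_ext)
    fix n
    show "fps_nth ((1 - fps_const ?q * fps_X) * fps_deriv ?N) n = fps_nth (fps_const (\<alpha> * ?q) * ?N) n"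
      unfolding fps_const_X_nth using nb_mass_Suc[of n \<alpha> p]
      by (cases n) (simp_all add: algebra_simps)
  qed
  have "fps_deriv ?N = ((1 - fps_const ?q * fps_X) * geo_fps ?q) * fps_deriv ?N" by (simp add: geo_fps_inverse)
  also have "\<dots> = geo_fps ?q * ((1 - fps_const ?q * fps_X) * fps_deriv ?N)" by (simp only: mult_ac)
  also have "\<dots> = ?N * (fps_const (\<alpha> * ?q) * geo_fps ?q)" unfolding ode by (simp only: mult_ac)
  finally show ?thesis .
qed

lemma nb_fps_deriv_l1: "l1 (fps_deriv (nb_fps \<alpha> p))"
  unfolding nb_fps_deriv using p by simp

text \<open>Summing the recursion over k >= m shows that the two sides differ by p times the sum of
  j \<pi>(j + m), which is nonnegative. With \<open>nb_head_moment\<close> this supplies the rate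
  inequalities of \<open>stein_kernel_bound\<close>.\<close>

lemma nb_tail_moment: "(1 - p) * (\<alpha> + real m) * (\<Sum>j. nb_mass \<alpha> p (j + m)) \<ge> real m * (\<Sum>j. nb_mass \<alpha> p (j + Suc m))"
proof -
  define q where "q = 1 - p"
  let ?\<pi> = "nb_mass \<alpha> p"
  have s: "summable ?\<pi>" using nb_mass_sums by (rule sums_summable)
  have s1: "summable (\<lambda>k. real k * ?\<pi> k)"
    using l1_deriv_sums(1)[OF nb_fps_deriv_l1] nb_mass_pos by (simp add: abs_of_pos)
  define G where "G = (\<Sum>j. ?\<pi> (j + m))"
  define T where "T = (\<Sum>j. real j * ?\<pi> (j + m))"
  have sG: "summable (\<lambda>j. ?\<pi> (j + m))" using s by (subst summable_iff_shift)
  have sm: "summable (\<lambda>j. real (j + m) * ?\<pi> (j + m))"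
    using s1 by (subst summable_iff_shift[of "\<lambda>k. real k * ?\<pi> k"])
  have sT: "summable (\<lambda>j. real j * ?\<pi> (j + m))"
    using summable_diff[OF sm summable_mult[OF sG, of "real m"]] by (simp add: algebra_simps)
  have T0: "0 \<le> T" unfolding T_def by (rule suminf_nonneg[OF sT]) (simp add: nb_mass_pos less_imp_le)
  have G': "(\<Sum>j. ?\<pi> (j + Suc m)) = G - ?\<pi> m"
    unfolding G_def using suminf_split_head[OF sG] by simp
  have A: "(\<Sum>j. real (j + m) * ?\<pi> (j + m)) = T + real m * G"
    unfolding T_def G_def using suminf_add[OF sT summable_mult[OF sG, of "real m"]] suminf_mult[OF sG, of "real m"]
    by (simp add: algebra_simps)
  have "(\<Sum>j. real (Suc (j + m)) * ?\<pi> (Suc (j + m))) = T + real m * G - real m * ?\<pi> m"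
    using suminf_split_head[OF sm] A by simp
  also have "(\<Sum>j. real (Suc (j + m)) * ?\<pi> (Suc (j + m))) = (\<Sum>j. q * (real j * ?\<pi> (j + m)) + q * (\<alpha> + real m) * ?\<pi> (j + m))"
    unfolding nb_mass_Suc q_def by (simp add: algebra_simps)
  also have "\<dots> = q * T + q * (\<alpha> + real m) * G"
    unfolding T_def G_def
    using suminf_add[OF summable_mult[OF sT, of q] summable_mult[OF sG, of "q * (\<alpha> + real m)"]]
      suminf_mult[OF sG, of "q * (\<alpha> + real m)"] suminf_mult[OF sT, of q] by simp
  finally have "q * (\<alpha> + real m) * G - real m * (G - ?\<pi> m) = p * T" by (simp add: q_def algebra_simps)
  moreover have "0 \<le> p * T" using p T0 by simp
  ultimately show ?thesis unfolding G' G_def[symmetric] q_def[symmetric] by linarith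
qed

text \<open>The gap is exactly p times the sum of the distribution function up to j, by induction on
  the recursion.\<close>

lemma nb_head_moment:
  "(1 - p) * (\<alpha> + real (Suc j)) * (\<Sum>k\<le>j. nb_mass \<alpha> p k) \<le> real (Suc j) * (\<Sum>k\<le>Suc j. nb_mass \<alpha> p k)"
proof -
  let ?F = "\<lambda>m. \<Sum>k\<le>m. nb_mass \<alpha> p k"
  have "real (Suc j) * ?F (Suc j) - (1 - p) * (\<alpha> + real (Suc j)) * ?F j = p * (\<Sum>i\<le>j. ?F i)"
  proof (induction j)
    case 0
    show ?case using nb_mass_Suc[of 0 \<alpha> p] by (simp add: algebra_simps)
  next
    case (Suc j)
    show ?case using Suc nb_mass_Suc[of "Suc j" \<alpha> p] by (simp add: algebra_simps)
  qed
  moreover have "0 \<le> p * (\<Sum>i\<le>j. ?F i)"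
    using p by (intro mult_nonneg_nonneg sum_nonneg) (auto simp: nb_mass_pos less_imp_le)
  ultimately show ?thesis by linarith
qed

text \<open>The operator generates a birth-death chain whose stationary law is negative binomial,
  and \<open>c\<close> is the mean of \<open>f\<close> under that law. Detailed balance turns the
  equation into a telescoping one, solved by centred partial sums divided by birth rate times
  mass.\<close>

lemma nb_stein_solution:
  fixes f :: "nat \<Rightarrow> real"
  assumes f: "\<And>m. 0 \<le> f m" "\<And>m. f m \<le> 1"
  obtains g c C where
    "\<And>m. (1 - p) * (\<alpha> + real m) * g (m + 1) - real m * g m = f m - c"
    "\<And>m. \<bar>g m\<bar> \<le> C"
    "\<And>m. m \<ge> 1 \<Longrightarrow> \<bar>g (m + 1) - g m\<bar> \<le> 1 / (\<alpha> * (1 - p))"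
proof -
  define q where "q = 1 - p"
  have q: "0 < q" using p by (simp add: q_def)
  define \<pi> where "\<pi> = nb_mass \<alpha> p"
  have \<pi>: "0 < \<pi> m" for m by (simp add: \<pi>_def nb_mass_pos)
  have \<pi>s: "\<pi> sums 1" unfolding \<pi>_def by (rule nb_mass_sums)
  have le: "\<pi> k * f k \<le> \<pi> k" "0 \<le> \<pi> k * f k" for k
    using mult_left_le[OF f(2)[of k], of "\<pi> k"] mult_nonneg_nonneg[OF _ f(1)[of k], of "\<pi> k"] \<pi>[of k] by auto
  have sf: "summable (\<lambda>k. \<pi> k * f k)"
  proof (rule summable_comparison_test'[OF sums_summable[OF \<pi>s], where N = 0])
    show "norm (\<pi> k * f k) \<le> \<pi> k" for k using le[of k] unfolding real_norm_def by linarith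
  qed
  define c where "c = (\<Sum>k. \<pi> k * f k)"
  define F where "F m = (\<Sum>k\<le>m. \<pi> k)" for m
  define G where "G m = (\<Sum>k. \<pi> (k + Suc m))" for m
  define s where "s m = (\<Sum>k\<le>m. \<pi> k * f k)" for m
  define t where "t m = (\<Sum>k. \<pi> (k + Suc m) * f (k + Suc m))" for m
  have rec: "real (Suc m) * \<pi> (Suc m) = q * (\<alpha> + real m) * \<pi> m" for m
    unfolding \<pi>_def q_def by (rule nb_mass_Suc)
  have FG: "F m + G m = 1" for m
    using suminf_split_initial_segment[OF sums_summable[OF \<pi>s], of "Suc m"] sums_unique[OF \<pi>s]
    by (simp add: F_def G_def lessThan_Suc_atMost)
  have c: "c = s m + t m" for m
    using suminf_split_initial_segment[OF sf, of "Suc m"]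
    by (simp add: c_def s_def t_def lessThan_Suc_atMost)
  have F0: "0 \<le> F m" for m unfolding F_def by (intro sum_nonneg) (simp add: \<pi> less_imp_le)
  have sG: "summable (\<lambda>k. \<pi> (k + Suc m))" for m using sums_summable[OF \<pi>s] by (subst summable_iff_shift)
  have st: "summable (\<lambda>k. \<pi> (k + Suc m) * f (k + Suc m))" for m
    using sf by (subst summable_iff_shift[of "\<lambda>k. \<pi> k * f k"])
  have s: "0 \<le> s m" "s m \<le> F m" for m unfolding s_def F_def by (auto intro!: sum_nonneg sum_mono le)
  have t: "0 \<le> t m" "t m \<le> G m" for m
    unfolding t_def G_def by (rule suminf_nonneg[OF st] suminf_le[OF _ st sG], rule le)+
  have G0: "0 \<le> G m" for m using t[of m] by linarith
  have FS: "F (Suc m) = F m + \<pi> (Suc m)" for m by (simp add: F_def)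
  have sS: "s (Suc m) = s m + \<pi> (Suc m) * f (Suc m)" for m by (simp add: s_def)
  have GS: "G m = \<pi> (Suc m) + G (Suc m)" for m using FG[of m] FG[of "Suc m"] FS[of m] by simp
  have i: "q * (\<alpha> + real (Suc j)) * F j \<le> real (Suc j) * F (Suc j)" for j
    unfolding q_def F_def \<pi>_def by (rule nb_head_moment)
  have ii: "real (Suc j) * G (Suc j) \<le> q * (\<alpha> + real (Suc j)) * G j" for j
    unfolding q_def G_def \<pi>_def by (rule nb_tail_moment)
  \<comment> \<open>The value at 0 is a free choice, since the equation multiplies it by m =
    0.\<close>
  define g where "g m = (case m of 0 \<Rightarrow> 0 | Suc j \<Rightarrow> (s j - F j * c) / (q * (\<alpha> + real j) * \<pi> j))" for m
  have b: "0 < q * (\<alpha> + real j)" for j using q \<alpha> by simp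
  have g': "g (Suc j) = (s j - F j * c) / (real (Suc j) * \<pi> (Suc j))" for j
    unfolding g_def rec by simp
  show thesis
  proof (rule that[of g c])
    fix m show "(1 - p) * (\<alpha> + real m) * g (m + 1) - real m * g m = f m - c"
    proof (cases m)
      case 0
      show ?thesis using \<pi>[of 0] \<alpha> q unfolding 0 q_def[symmetric]
        by (simp add: g_def s_def F_def field_simps)
    next
      case (Suc j)
      have "q * (\<alpha> + real (Suc j)) * g (Suc (Suc j)) = (s (Suc j) - F (Suc j) * c) / \<pi> (Suc j)"
        using q \<alpha> by (simp add: g_def)
      moreover have "real (Suc j) * g (Suc j) = (s j - F j * c) / \<pi> (Suc j)"
        unfolding g' by simp
      moreover have "(s (Suc j) - F (Suc j) * c) / \<pi> (Suc j) - (s j - F j * c) / \<pi> (Suc j) = f (Suc j) - c"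
        using \<pi>[of "Suc j"] unfolding sS FS by (simp add: field_simps)
      ultimately show ?thesis unfolding Suc q_def[symmetric] by simp
    qed
  next
    \<comment> \<open>For boundedness of \<open>g\<close>: the centred partial sum is at most the
      tail \<open>G j\<close> in modulus, and the ratio of the tail to birth rate times mass
      decreases by the tail inequality, so its value at 0 bounds all of them.\<close>
    have G_dec: "G j / (q * (\<alpha> + real j) * \<pi> j) \<le> G 0 / (q * \<alpha> * \<pi> 0)" for j
    proof (induction j)
      case (Suc j)
      have "G (Suc j) / (q * (\<alpha> + real (Suc j)) * \<pi> (Suc j)) \<le> G j / (real (Suc j) * \<pi> (Suc j))"
        using ii[of j] b[of "Suc j"] \<pi>[of "Suc j"] by (simp add: divide_simps mult_ac)
      also have "\<dots> = G j / (q * (\<alpha> + real j) * \<pi> j)" unfolding rec ..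
      finally show ?case using Suc by simp
    qed simp
    fix m show "\<bar>g m\<bar> \<le> G 0 / (q * \<alpha> * \<pi> 0)"
    proof (cases m)
      case 0
      show ?thesis unfolding 0 using G0 q \<alpha> \<pi>[of 0] by (simp add: g_def)
    next
      case (Suc j)
      have "s j - F j * c = G j * s j - F j * t j"
      proof -
        have "s j = (F j + G j) * s j" using FG[of j] by simp
        thus ?thesis unfolding c[of j] by (simp add: algebra_simps)
      qed
      moreover have "G j * s j \<le> G j" "0 \<le> G j * s j" "F j * t j \<le> G j" "0 \<le> F j * t j"
        using s[of j] t[of j] G0[of j] F0[of j] FG[of j] mult_mono[of "F j" 1 "t j" "G j"]
        by (auto intro!: mult_left_le)
      ultimately have "\<bar>s j - F j * c\<bar> \<le> G j" by linarith
      hence "\<bar>g (Suc j)\<bar> \<le> G j / (q * (\<alpha> + real j) * \<pi> j)"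
        using abs_of_pos[OF mult_pos_pos[OF b[of j] \<pi>[of j]]] mult_pos_pos[OF b[of j] \<pi>[of j]]
        unfolding g_def nat.case abs_divide by (simp only: divide_right_mono less_imp_le)
      thus ?thesis unfolding Suc using G_dec[of j] by linarith
    qed
  next
    fix m :: nat assume "m \<ge> 1"
    then obtain j where m: "m = Suc j" by (cases m) auto
    have c': "c = s j + \<pi> (Suc j) * f (Suc j) + t (Suc j)" using c[of "Suc j"] sS[of j] by simp
    have "\<bar>g (m + 1) - g m\<bar> \<le> 1 / (q * (\<alpha> + real (Suc j)))"
    proof -
      have "\<bar>(s j + \<pi> (Suc j) * f (Suc j) - (F j + \<pi> (Suc j)) * c) / (q * (\<alpha> + real (Suc j)) * \<pi> (Suc j))
          - (s j - F j * c) / (real (Suc j) * \<pi> (Suc j))\<bar> \<le> 1 / (q * (\<alpha> + real (Suc j)))"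
        unfolding c'
      proof (rule stein_kernel_bound)
        show "F j + \<pi> (Suc j) + G (Suc j) = 1" using FG[of "Suc j"] FS by simp
        show "q * (\<alpha> + real (Suc j)) * F j \<le> real (Suc j) * (F j + \<pi> (Suc j))" using i[of j] FS by simp
        show "real (Suc j) * G (Suc j) \<le> q * (\<alpha> + real (Suc j)) * (G (Suc j) + \<pi> (Suc j))"
          using ii[of j] GS[of j] by (simp add: add.commute)
      qed (rule s t f \<pi> b of_nat_0_less_iff[THEN iffD2] zero_less_Suc)+
      moreover have "g (m + 1) = (s j + \<pi> (Suc j) * f (Suc j) - (F j + \<pi> (Suc j)) * c) / (q * (\<alpha> + real (Suc j)) * \<pi> (Suc j))"
        unfolding m g_def by (simp add: sS FS)
      moreover have "g m = (s j - F j * c) / (real (Suc j) * \<pi> (Suc j))" unfolding m by (rule g')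
      ultimately show ?thesis by (simp only:)
    qed
    also have "\<dots> \<le> 1 / (q * \<alpha>)" using q \<alpha> by (intro divide_left_mono) auto
    finally show "\<bar>g (m + 1) - g m\<bar> \<le> 1 / (\<alpha> * (1 - p))" by (simp add: q_def mult.commute)
  qed
qed

text \<open>For \<alpha> <= 1 the recursion makes the masses decrease, so their differences
  telescope to the mass at 0; coefficient 0 contributes that mass once more.\<close>

lemma nb_fps_diff_norm:
  assumes "\<alpha> \<le> 1"
  shows "l1norm ((1 - fps_X) * nb_fps \<alpha> p) \<le> 2 * p powr \<alpha>"
proof -
  let ?\<pi> = "nb_mass \<alpha> p"
  have dec: "?\<pi> (Suc m) \<le> ?\<pi> m" for m
  proof -
    have "real (Suc m) * ?\<pi> (Suc m) \<le> (1 * real (Suc m)) * ?\<pi> m"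
      unfolding nb_mass_Suc
      by (intro mult_right_mono mult_mono) (use assms \<alpha> p nb_mass_pos in \<open>auto simp: less_imp_le\<close>)
    thus ?thesis by (simp del: of_nat_Suc)
  qed
  have lim: "?\<pi> \<longlonglongrightarrow> 0" by (rule summable_LIMSEQ_zero[OF sums_summable[OF nb_mass_sums]])
  have "(\<lambda>n. ?\<pi> n - ?\<pi> (Suc n)) sums (?\<pi> 0 - 0)" by (rule telescope_sums'[OF lim])
  hence "(\<lambda>n. \<bar>fps_nth ((1 - fps_X) * nb_fps \<alpha> p) (Suc n)\<bar>) sums ?\<pi> 0"
  proof -
    have "\<bar>fps_nth ((1 - fps_X) * nb_fps \<alpha> p) (Suc n)\<bar> = ?\<pi> n - ?\<pi> (Suc n)" for n
      unfolding one_minus_X_nth using dec[of n] by simp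
    with \<open>(\<lambda>n. ?\<pi> n - ?\<pi> (Suc n)) sums (?\<pi> 0 - 0)\<close> show ?thesis by simp
  qed
  hence "(\<lambda>n. \<bar>fps_nth ((1 - fps_X) * nb_fps \<alpha> p) n\<bar>) sums (?\<pi> 0 + ?\<pi> 0)"
    by (subst (asm) sums_Suc_iff) (simp add: one_minus_X_nth nb_mass_pos abs_of_pos)
  hence "l1norm ((1 - fps_X) * nb_fps \<alpha> p) = ?\<pi> 0 + ?\<pi> 0"
    unfolding l1norm_def by (rule sums_unique[symmetric])
  thus ?thesis unfolding nb_mass_0 by linarith
qed

end

section \<open>Smoothness of sums of independent variables\<close>

definition half_walk :: "real fps" where
  "half_walk = fps_const (1/2) * (1 + fps_X)"

lemma half_walk_l1 [simp]: "l1 half_walk" "coeff_sum half_walk = 1"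
  by (simp_all add: half_walk_def)

text \<open>With n = N + 2, \<open>L\<close> multiplies coefficient k by n - 2k. Hence
  \<open>L (L B)\<close> has nonnegative coefficients, and its norm is its value at 1, the second
  moment n 2^n of the unnormalised simple walk. Since n (n - 1) (1 - X)^2 (1 + X)^N = L (L B) - n B,
  the triangle inequality gives the bound.\<close>

lemma half_walk_second_difference:
  "l1norm ((1 - fps_X) ^ 2 * half_walk ^ N) \<le> 8 / (real N + 1)"
proof -
  define n where "n = real N + 2"
  define c :: "real fps" where "c = fps_const (real N)"
  define B :: "real fps" where "B = (1 + fps_X) ^ (N + 2)"
  define L :: "real fps \<Rightarrow> real fps" where "L f = (c + 2) * f - 2 * fps_X * fps_deriv f" for f
  have two: "(2 :: real fps) = fps_const 2" by (simp add: numeral_fps_const)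
  have c2: "c + 2 = fps_const n" by (simp add: c_def n_def two)
  have L_nth: "fps_nth (L f) k = (n - 2 * real k) * fps_nth f k" for f k
  proof -
    have "fps_nth (2 * fps_X * fps_deriv f) k = 2 * (real k * fps_nth f k)"
      unfolding two mult.assoc fps_mult_left_const_nth by (cases k) (simp_all)
    thus ?thesis unfolding L_def c2 fps_sub_nth fps_mult_left_const_nth by (simp add: algebra_simps)
  qed
  have d2: "fps_deriv B = (c + 2) * (1 + fps_X) * (1 + fps_X) ^ N"
    unfolding B_def fps_deriv_power by (simp add: c_def two algebra_simps flip: fps_const_add)
  have B: "B = (1 + fps_X) * (1 + fps_X) * (1 + fps_X) ^ N" by (simp add: B_def mult_ac)
  have L1: "L B = (c + 2) * ((1 - fps_X) * ((1 + fps_X) * (1 + fps_X) ^ N))"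
    unfolding L_def d2 unfolding B by (simp add: algebra_simps)
  have "fps_deriv ((1 + fps_X) ^ Suc N) = (c + 1) * (1 + fps_X :: real fps) ^ N"
    unfolding fps_deriv_power by (simp add: c_def algebra_simps flip: fps_const_add)
  hence d3: "fps_deriv ((1 + fps_X) * (1 + fps_X) ^ N) = (c + 1) * (1 + fps_X :: real fps) ^ N" by simp
  have d4: "fps_deriv (L B) = (c + 2) * ((1 - fps_X) * ((c + 1) * (1 + fps_X) ^ N) - (1 + fps_X) * (1 + fps_X) ^ N)"
  proof -
    have "fps_deriv ((c + 2) * ((1 - fps_X) * Q)) = (c + 2) * ((1 - fps_X) * fps_deriv Q - Q)" for Q
      unfolding c2 by (simp add: algebra_simps)
    thus ?thesis unfolding L1 by (simp only: d3)
  qed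
  have LL: "L (L B) = (c + 2) * (1 + fps_X) ^ N * ((c + 1) * (1 - fps_X) ^ 2 + (1 + fps_X) ^ 2)"
    unfolding L_def[of "L B"] d4 unfolding L1 power2_eq_square by (simp add: algebra_simps)
  have main: "(c + 2) * ((c + 1) * ((1 - fps_X) ^ 2 * (1 + fps_X) ^ N)) = L (L B) - (c + 2) * B"
    unfolding LL unfolding B power2_eq_square by (simp add: algebra_simps)
  have c1: "c + 1 = fps_const (n - 1)" by (simp add: c_def n_def flip: fps_const_1_eq_1)
  have Bpos: "0 \<le> fps_nth B k" for k
  proof -
    have "0 \<le> fps_nth ((1 + fps_X :: real fps) ^ m) k" for m k
      by (induction m arbitrary: k) (auto intro!: fps_mult_nonneg simp: fps_X_def)
    thus ?thesis unfolding B_def .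
  qed
  have nB: "l1norm B = 2 ^ (N + 2)" using Bpos by (simp add: l1norm_eq_coeff_sum B_def)
  have "l1 B" by (simp add: B_def)
  moreover have "l1 (L (L B))" unfolding LL by (simp add: c_def two)
  ultimately have l: "l1 B" "l1 (L (L B))" .
  have nL: "l1norm (L (L B)) = n * 2 ^ (N + 2)"
  proof -
    have "0 \<le> fps_nth (L (L B)) k" for k unfolding L_nth by (simp add: Bpos flip: mult.assoc)
    hence "l1norm (L (L B)) = coeff_sum (L (L B))" by (rule l1norm_eq_coeff_sum)
    thus ?thesis unfolding LL c1 c2 by (simp add: mult_ac)
  qed
  have "n * ((n - 1) * l1norm ((1 - fps_X) ^ 2 * (1 + fps_X) ^ N)) = l1norm (L (L B) - fps_const n * B)"
    unfolding main[unfolded c1 c2, symmetric] by (simp add: l1norm_const_mult n_def)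
  also have "\<dots> \<le> n * 2 ^ (N + 2) + n * 2 ^ (N + 2)"
    using l1norm_diff[of "L (L B)" "fps_const n * B"] l by (simp add: nL nB l1norm_const_mult n_def)
  finally have "n * ((n - 1) * l1norm ((1 - fps_X) ^ 2 * (1 + fps_X) ^ N)) \<le> n * (8 * 2 ^ N)"
    by (simp add: algebra_simps)
  hence le: "(real N + 1) * l1norm ((1 - fps_X) ^ 2 * (1 + fps_X) ^ N) \<le> 8 * 2 ^ N"
    by (simp add: n_def add.commute)
  have eq: "l1norm ((1 - fps_X) ^ 2 * half_walk ^ N) = (1/2) ^ N * l1norm ((1 - fps_X) ^ 2 * (1 + fps_X) ^ N)"
  proof -
    have "(1 - fps_X) ^ 2 * half_walk ^ N = fps_const ((1/2) ^ N) * ((1 - fps_X) ^ 2 * (1 + fps_X) ^ N)"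
      unfolding half_walk_def power_mult_distrib fps_const_power by (simp only: mult_ac)
    thus ?thesis by (simp only:) (subst l1norm_const_mult, simp_all)
  qed
  have "(real N + 1) * l1norm ((1 - fps_X) ^ 2 * half_walk ^ N) \<le> (1/2) ^ N * (8 * 2 ^ N)"
    using mult_left_mono[OF le, of "(1/2) ^ N"] unfolding eq by (simp only: mult_ac) simp
  also have "\<dots> = 8" by (simp add: power_one_over)
  finally show ?thesis by (simp add: pos_le_divide_eq mult.commute)
qed

lemma integral_power_01: "integral {0..1} (\<lambda>t::real. t ^ j) = 1 / (real j + 1)"
proof -
  have "((\<lambda>t::real. t ^ j) has_integral (1 ^ Suc j / real (Suc j) - 0 ^ Suc j / real (Suc j))) {0..1}"
  proof (rule fundamental_theorem_of_calculus)
    fix x :: real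
    have "((\<lambda>t. t ^ Suc j / real (Suc j)) has_real_derivative (real (Suc j) * x ^ j) / real (Suc j)) (at x within {0..1})"
      using DERIV_pow[of "Suc j" x "{0..1}"] by (intro DERIV_cdivide) simp
    thus "((\<lambda>t. t ^ Suc j / real (Suc j)) has_vector_derivative x ^ j) (at x within {0..1})"
      by (simp add: has_real_derivative_iff_has_vector_derivative del: of_nat_Suc power_Suc)
  qed simp
  thus ?thesis by (simp add: integral_unique add.commute)
qed

text \<open>Taking either \<open>half_walk * U i\<close> or \<open>R i\<close> from each factor
  makes the number N of coins random. Writing 1 / (N + 1) as the integral of t^N turns the average
  over N into the integral of a product, built up one factor at a time; \<open>j\<close> counts
  coins already taken.\<close>

lemma mixture_second_difference:
  fixes P U R :: "nat \<Rightarrow> real fps" and a :: "nat \<Rightarrow> real"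
  assumes "\<And>i. i \<in> {1..n} \<Longrightarrow> P i = half_walk * U i + R i"
    and "\<And>i. i \<in> {1..n} \<Longrightarrow> l1 (U i) \<and> l1 (R i) \<and> l1norm (U i) = a i \<and> l1norm (R i) = 1 - a i"
  shows "l1norm ((1 - fps_X) ^ 2 * half_walk ^ j * (\<Prod>i=1..n. P i))
           \<le> 8 * integral {0..1} (\<lambda>t. t ^ j * (\<Prod>i=1..n. 1 - a i + a i * t))"
  using assms
proof (induction n arbitrary: j)
  case 0
  show ?case using half_walk_second_difference[of j] by (simp add: integral_power_01)
next
  case (Suc n)
  let ?M = "\<Prod>i=1..n. P i" and ?D = "\<lambda>j. (1 - fps_X) ^ 2 * half_walk ^ j" and ?m = "Suc n"
  let ?\<Pi> = "\<lambda>t. \<Prod>i=1..n. 1 - a i + a i * t"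
  have P: "P ?m = half_walk * U ?m + R ?m" using Suc.prems by simp
  have l: "l1 (U ?m)" "l1 (R ?m)" "l1norm (U ?m) = a ?m" "l1norm (R ?m) = 1 - a ?m" using Suc.prems(2)[of ?m] by auto
  have nn: "0 \<le> a ?m" "0 \<le> 1 - a ?m" using l1norm_nonneg[OF l(1)] l1norm_nonneg[OF l(2)] l(3,4) by auto
  have lM: "l1 ?M" using Suc.prems by (intro l1_prod) auto
  have IH: "l1norm (?D j * ?M) \<le> 8 * integral {0..1} (\<lambda>t. t ^ j * ?\<Pi> t)" for j
    using Suc.prems by (intro Suc.IH) auto
  have int: "(\<lambda>t. t ^ j * ?\<Pi> t) integrable_on {0..1}" for j
    by (intro integrable_continuous_interval continuous_intros)
  have "?D j * (\<Prod>i=1..Suc n. P i) = (?D (Suc j) * ?M) * U ?m + (?D j * ?M) * R ?m"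
    by (simp add: P algebra_simps)
  hence "l1norm (?D j * (\<Prod>i=1..Suc n. P i)) \<le> l1norm ((?D (Suc j) * ?M) * U ?m) + l1norm ((?D j * ?M) * R ?m)"
    using l1norm_add[of "(?D (Suc j) * ?M) * U ?m" "(?D j * ?M) * R ?m"] l lM by simp
  also have "\<dots> \<le> l1norm (?D (Suc j) * ?M) * a ?m + l1norm (?D j * ?M) * (1 - a ?m)"
    using l1norm_mult[of "?D (Suc j) * ?M" "U ?m"] l1norm_mult[of "?D j * ?M" "R ?m"] l lM by simp
  also have "\<dots> \<le> 8 * integral {0..1} (\<lambda>t. t ^ Suc j * ?\<Pi> t) * a ?m + 8 * integral {0..1} (\<lambda>t. t ^ j * ?\<Pi> t) * (1 - a ?m)"
    by (intro add_mono mult_right_mono IH nn)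
  also have "\<dots> = 8 * integral {0..1} (\<lambda>t. t ^ Suc j * ?\<Pi> t * a ?m + t ^ j * ?\<Pi> t * (1 - a ?m))"
  proof -
    have "((\<lambda>t. t ^ Suc j * ?\<Pi> t * a ?m + t ^ j * ?\<Pi> t * (1 - a ?m)) has_integral
        integral {0..1} (\<lambda>t. t ^ Suc j * ?\<Pi> t) * a ?m + integral {0..1} (\<lambda>t. t ^ j * ?\<Pi> t) * (1 - a ?m)) {0..1}"
      by (intro has_integral_add has_integral_mult_left integrable_integral int)
    from integral_unique[OF this] show ?thesis by (simp only: distrib_left mult.assoc)
  qed
  also have "(\<lambda>t. t ^ Suc j * ?\<Pi> t * a ?m + t ^ j * ?\<Pi> t * (1 - a ?m)) = (\<lambda>t. t ^ j * (\<Prod>i=1..Suc n. 1 - a i + a i * t))"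
    by (auto simp: algebra_simps)
  finally show ?case .
qed

text \<open>From 1 - a (1 - t) <= exp (- a (1 - t)) the product is at most exp (- \<Lambda> (1 -
  t)), which integrates to (1 - exp (- \<Lambda>)) / \<Lambda>.\<close>

lemma integral_prod_mixture:
  fixes a :: "nat \<Rightarrow> real"
  assumes a: "\<And>i. i \<in> {1..n} \<Longrightarrow> 0 \<le> a i \<and> a i \<le> 1" and pos: "0 < (\<Sum>i=1..n. a i)"
  shows "integral {0..1} (\<lambda>t. \<Prod>i=1..n. 1 - a i + a i * t) \<le> 1 / (\<Sum>i=1..n. a i)"
proof -
  define \<Lambda> where "\<Lambda> = (\<Sum>i=1..n. a i)"
  have \<Lambda>: "0 < \<Lambda>" using pos by (simp add: \<Lambda>_def)
  have hi: "((\<lambda>t. exp (- \<Lambda> * (1 - t))) has_integral (exp (- \<Lambda> * (1 - 1)) / \<Lambda> - exp (- \<Lambda> * (1 - 0)) / \<Lambda>)) {0..1}"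
  proof (rule fundamental_theorem_of_calculus)
    fix x :: real
    have "((\<lambda>t. exp (- \<Lambda> * (1 - t)) / \<Lambda>) has_real_derivative exp (- \<Lambda> * (1 - x))) (at x within {0..1})"
      using \<Lambda> by (auto intro!: derivative_eq_intros simp: field_simps)
    thus "((\<lambda>t. exp (- \<Lambda> * (1 - t)) / \<Lambda>) has_vector_derivative exp (- \<Lambda> * (1 - x))) (at x within {0..1})"
      by (rule has_real_derivative_iff_has_vector_derivative[THEN iffD1])
  qed simp
  have "integral {0..1} (\<lambda>t. \<Prod>i=1..n. 1 - a i + a i * t) \<le> integral {0..1} (\<lambda>t. exp (- \<Lambda> * (1 - t)))"
  proof (rule integral_le)
    show "(\<lambda>t. \<Prod>i=1..n. 1 - a i + a i * t) integrable_on {0..1}"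
      by (intro integrable_continuous_interval continuous_intros)
    show "(\<lambda>t. exp (- \<Lambda> * (1 - t))) integrable_on {0..1}" using hi by blast
    fix t :: real assume t: "t \<in> {0..1}"
    have "(\<Prod>i=1..n. 1 - a i + a i * t) \<le> (\<Prod>i=1..n. exp (- a i * (1 - t)))"
    proof (rule prod_mono)
      fix i assume i: "i \<in> {1..n}"
      have "1 + - a i * (1 - t) \<le> exp (- a i * (1 - t))" by (rule exp_ge_add_one_self)
      thus "0 \<le> 1 - a i + a i * t \<and> 1 - a i + a i * t \<le> exp (- a i * (1 - t))"
        using mult_mono[of "a i" 1 "1 - t" 1] a[OF i] t by (auto simp: algebra_simps)
    qed
    also have "\<dots> = exp (- \<Lambda> * (1 - t))"
      by (simp add: exp_sum[symmetric] \<Lambda>_def sum_distrib_right sum_negf)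
    finally show "(\<Prod>i=1..n. 1 - a i + a i * t) \<le> exp (- \<Lambda> * (1 - t))" .
  qed
  also have "\<dots> = (1 - exp (- \<Lambda>)) / \<Lambda>" using integral_unique[OF hi] by (simp add: diff_divide_distrib)
  also have "\<dots> \<le> 1 / \<Lambda>" using \<Lambda> by (intro divide_right_mono) auto
  finally show ?thesis by (simp add: \<Lambda>_def)
qed

section \<open>Laws on the naturals and their coin component\<close>

lemma pgf_fps_nth [simp]: "fps_nth (pgf_fps X) k = pmf X k"
  by (simp add: pgf_fps_def)

lemma pmf_nat_sums: "pmf X sums 1" for X :: "nat pmf"
proof -
  have "(\<lambda>i. measure (measure_pmf X) {i}) sums measure (measure_pmf X) (\<Union>i. {i})"
    by (rule measure_pmf.finite_measure_UNION) (auto simp: disjoint_family_on_def)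
  moreover have "(\<Union>i::nat. {i}) = UNIV" by auto
  ultimately show ?thesis using measure_pmf.prob_space[of X] by (simp add: measure_pmf_single)
qed

lemma pgf_fps_l1 [simp]: "l1 (pgf_fps X)" "coeff_sum (pgf_fps X) = 1"
  using pmf_nat_sums[of X] by (auto simp: l1_def coeff_sum_def sums_iff)

text \<open>The mass common to X and X + 1. Compared with the summands of \<Psi> the cap 1/2 is
  absent, which can only enlarge the sum.\<close>

definition overlap :: "nat pmf \<Rightarrow> real" where
  "overlap X = 1 - dtv (pmf X) (shift1 (pmf X))"

definition overlap_fps :: "nat pmf \<Rightarrow> real fps" where
  "overlap_fps X = Abs_fps (\<lambda>m. min (pmf X m) (pmf X (Suc m)))"

text \<open>Summation of 2 min x y = x + y - |y - x| over neighbouring masses; the terms at 0 are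
  split off separately because of the shift.\<close>

lemma overlap_sums: "(\<lambda>m. min (pmf X m) (pmf X (Suc m))) sums overlap X"
proof -
  have s: "summable (\<lambda>m. \<bar>pmf X m - shift1 (pmf X) m\<bar>)"
  proof -
    have "(1 - fps_X) * pgf_fps X = Abs_fps (\<lambda>m. pmf X m - shift1 (pmf X) m)"
      by (rule fps_ext) (auto simp: one_minus_X_nth shift1_def)
    moreover have "l1 ((1 - fps_X) * pgf_fps X)" by simp
    ultimately show ?thesis by (simp add: l1_def)
  qed
  have "(\<lambda>m. \<bar>pmf X m - shift1 (pmf X) m\<bar>) sums (2 * dtv (pmf X) (shift1 (pmf X)))"
    using s by (simp add: dtv_def sums_iff)
  hence d: "(\<lambda>m. \<bar>pmf X (Suc m) - pmf X m\<bar>) sums (2 * dtv (pmf X) (shift1 (pmf X)) - pmf X 0)"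
    using sums_Suc_iff[of "\<lambda>m. \<bar>pmf X m - shift1 (pmf X) m\<bar>"] by (simp add: shift1_def)
  have p: "(\<lambda>m. pmf X (Suc m)) sums (1 - pmf X 0)" using sums_Suc_iff[of "pmf X"] pmf_nat_sums[of X] by simp
  have "(\<lambda>m. (1/2) * (pmf X m + pmf X (Suc m) - \<bar>pmf X (Suc m) - pmf X m\<bar>)) sums
      ((1/2) * (1 + (1 - pmf X 0) - (2 * dtv (pmf X) (shift1 (pmf X)) - pmf X 0)))"
    by (intro sums_mult sums_diff sums_add pmf_nat_sums p d)
  moreover have "(1/2) * (x + y - \<bar>y - x\<bar>) = min x y" for x y :: real by (simp add: min_def abs_if)
  ultimately show ?thesis by (simp add: overlap_def diff_divide_distrib)
qed

lemma overlap_fps_l1: "l1 (overlap_fps X)" "l1norm (overlap_fps X) = overlap X"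
  using overlap_sums[of X] by (simp_all add: l1_def l1norm_def overlap_fps_def sums_iff)

lemma overlap_nonneg: "0 \<le> overlap X"
  using l1norm_nonneg[OF overlap_fps_l1(1)[of X]] overlap_fps_l1(2)[of X] by simp

lemma overlap_le: "overlap X \<le> 1 - pmf X 0"
proof -
  have p: "(\<lambda>m. pmf X (Suc m)) sums (1 - pmf X 0)" using sums_Suc_iff[of "pmf X"] pmf_nat_sums[of X] by simp
  show ?thesis by (rule sums_le[OF _ overlap_sums p]) simp
qed

text \<open>With probability \<^term>\<open>overlap X\<close> the variable is an independent sum of a fair coin and something
  else (the Mineka coupling in mixture form).\<close>

lemma pgf_mixture:
  defines "R X \<equiv> pgf_fps X - half_walk * overlap_fps X"
  shows "pgf_fps X = half_walk * overlap_fps X + R X" "l1 (R X)" "l1norm (R X) = 1 - overlap X"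
proof -
  show "pgf_fps X = half_walk * overlap_fps X + R X" by (simp add: R_def)
  show l: "l1 (R X)" using overlap_fps_l1 by (simp add: R_def)
  \<comment> \<open>The coin brings to m half of the overlap coefficient at m and half of the one at
    m - 1; as minima of neighbouring masses, both are at most \<open>pmf X m\<close>.\<close>
  have "0 \<le> fps_nth (R X) m" for m
  proof -
    have "fps_nth (half_walk * overlap_fps X) m = (fps_nth (overlap_fps X) m + (if m = 0 then 0 else fps_nth (overlap_fps X) (m - 1))) / 2"
      by (simp add: half_walk_def mult.assoc distrib_right)
    also have "\<dots> \<le> pmf X m"
    proof -
      have "fps_nth (overlap_fps X) m \<le> pmf X m" by (simp add: overlap_fps_def)
      moreover have "(if m = 0 then 0 else fps_nth (overlap_fps X) (m - 1)) \<le> pmf X m"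
        by (cases m) (simp_all add: overlap_fps_def)
      moreover have "x \<le> z \<Longrightarrow> y \<le> z \<Longrightarrow> (x + y) / 2 \<le> z" for x y z :: real by simp
      ultimately show ?thesis by blast
    qed
    finally show ?thesis by (simp add: R_def)
  qed
  hence "l1norm (R X) = coeff_sum (R X)" by (rule l1norm_eq_coeff_sum)
  also have "\<dots> = 1 - coeff_sum (overlap_fps X)" using overlap_fps_l1 by (simp add: R_def)
  also have "coeff_sum (overlap_fps X) = overlap X"
    using l1norm_eq_coeff_sum[of "overlap_fps X"] overlap_fps_l1 by (simp add: overlap_fps_def)
  finally show "l1norm (R X) = 1 - overlap X" .
qed

lemma sum_second_difference:
  fixes X :: "nat \<Rightarrow> nat pmf"
  assumes "0 < (\<Sum>i=1..n. overlap (X i))"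
  shows "l1norm ((1 - fps_X) ^ 2 * (\<Prod>i=1..n. pgf_fps (X i))) \<le> 8 / (\<Sum>i=1..n. overlap (X i))"
proof -
  have "l1norm ((1 - fps_X) ^ 2 * half_walk ^ 0 * (\<Prod>i=1..n. pgf_fps (X i)))
           \<le> 8 * integral {0..1} (\<lambda>t. t ^ 0 * (\<Prod>i=1..n. 1 - overlap (X i) + overlap (X i) * t))"
    by (rule mixture_second_difference[where U = "\<lambda>i. overlap_fps (X i)"
          and R = "\<lambda>i. pgf_fps (X i) - half_walk * overlap_fps (X i)"])
      (use pgf_mixture overlap_fps_l1 in auto)
  also have "\<dots> \<le> 8 * (1 / (\<Sum>i=1..n. overlap (X i)))"
    using integral_prod_mixture[of n "\<lambda>i. overlap (X i)"] assms overlap_nonneg overlap_le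
    by (simp add: order_trans[OF overlap_le])
  finally show ?thesis by simp
qed

text \<open>Factorwise, P(X = 0) <= 1 - overlap <= exp (- overlap). The product on the left is P(Y =
  0) for the independent sum.\<close>

lemma prod_pmf_0_le: "(\<Prod>i=1..n. pmf (X i) 0) \<le> exp (- (\<Sum>i=1..n. overlap (X i)))" for n :: nat
proof -
  have "(\<Prod>i=1..n. pmf (X i) 0) \<le> (\<Prod>i=1..n. exp (- overlap (X i)))"
  proof (rule prod_mono)
    fix i
    show "0 \<le> pmf (X i) 0 \<and> pmf (X i) 0 \<le> exp (- overlap (X i))"
      using overlap_le[of "X i"] exp_ge_add_one_self[of "- overlap (X i)"] by simp
  qed
  thus ?thesis by (simp add: exp_sum[symmetric] sum_negf)
qed

lemma sum_law_eq: "sum_law X n = fps_nth (\<Prod>i=1..n. pgf_fps (X i))"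
proof (induction n)
  case (Suc n)
  show ?case by (rule ext) (simp add: Suc conv_def fps_mult_nth atLeast0AtMost)
qed auto

section \<open>Exponentials of power series\<close>

text \<open>The equation f' = f G computes each coefficient from the earlier ones, so the constant
  term determines the series.\<close>

lemma fps_log_deriv_unique:
  fixes f g G :: "real fps"
  assumes "fps_deriv f = f * G" "fps_deriv g = g * G" "fps_nth f 0 = fps_nth g 0"
  shows "f = g"
proof (rule fps_ext)
  fix n show "fps_nth f n = fps_nth g n"
  proof (induction n rule: less_induct)
    case (less n)
    show ?case
    proof (cases n)
      case (Suc m)
      have "real (Suc m) * fps_nth f (Suc m) = (\<Sum>i=0..m. fps_nth f i * fps_nth G (m - i))"
        using arg_cong[OF assms(1), of "\<lambda>h. fps_nth h m"] by (simp add: fps_mult_nth)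
      also have "\<dots> = (\<Sum>i=0..m. fps_nth g i * fps_nth G (m - i))"
        using less Suc by (intro sum.cong) auto
      also have "\<dots> = real (Suc m) * fps_nth g (Suc m)"
        using arg_cong[OF assms(2), of "\<lambda>h. fps_nth h m"] by (simp add: fps_mult_nth)
      finally show ?thesis unfolding Suc by (simp del: of_nat_Suc)
    qed (use assms in simp)
  qed
qed

lemma l1norm_power_le: "l1 f \<Longrightarrow> l1norm (f ^ k) \<le> l1norm f ^ k"
proof (induction k)
  case (Suc k)
  have "l1norm (f * f ^ k) \<le> l1norm f * l1norm (f ^ k)" using Suc by (intro l1norm_mult) auto
  also have "\<dots> \<le> l1norm f * l1norm f ^ k" using Suc by (intro mult_left_mono l1norm_nonneg) auto
  finally show ?case by simp
qed simp

text \<open>\<open>E\<close> is the exponential of the antiderivative \<open>h\<close> of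
  \<open>F\<close> with zero constant term. Integration divides coefficients by positive integers,
  so it does not raise the norm. The exponential is estimated on partial sums, so that only finite
  sums are interchanged.\<close>

lemma fps_exp_integral:
  assumes F: "l1 F"
  obtains E where "fps_deriv E = E * F" "fps_nth E 0 = 1" "l1 E" "l1norm E \<le> exp (l1norm F)"
proof -
  define h where "h = fps_integral F 0"
  define E where "E = fps_exp 1 oo h"
  have h0: "fps_nth h 0 = 0" by (simp add: h_def)
  have h': "fps_deriv h = F" by (simp add: h_def fps_deriv_fps_integral)
  have h: "l1 h" by (rule l1_deriv_imp_l1) (simp add: h' F)
  have hn: "l1norm h \<le> l1norm F"
  proof -
    have s: "summable (\<lambda>n. \<bar>fps_nth h n\<bar>)" using h by (simp add: l1_def)
    have "l1norm h = (\<Sum>n. \<bar>fps_nth h (Suc n)\<bar>)"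
      using suminf_split_head[OF s] h0 by (simp add: l1norm_def)
    also have "\<dots> \<le> l1norm F" unfolding l1norm_def
    proof (rule suminf_le)
      fix n
      have "\<bar>fps_nth h (Suc n)\<bar> = \<bar>fps_nth F n\<bar> / real (Suc n)"
        by (simp add: h_def field_simps abs_mult)
      also have "\<dots> \<le> \<bar>fps_nth F n\<bar>" using mult_left_mono[of 1 "real (Suc n)" "\<bar>fps_nth F n\<bar>"]
        by (simp add: divide_le_eq del: of_nat_Suc)
      finally show "\<bar>fps_nth h (Suc n)\<bar> \<le> \<bar>fps_nth F n\<bar>" .
    qed (use s F in \<open>auto simp: l1_def summable_Suc_iff[of "\<lambda>n. \<bar>fps_nth h n\<bar>"]\<close>)
    finally show ?thesis .
  qed
  have d: "fps_deriv E = E * F"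
    unfolding E_def by (simp add: fps_compose_deriv[OF h0] h')
  have part: "(\<Sum>n<M. \<bar>fps_nth E n\<bar>) \<le> exp (l1norm F)" for M
  proof -
    have "(\<Sum>n<M. \<bar>fps_nth E n\<bar>) \<le> (\<Sum>n<M. \<Sum>k<M. \<bar>fps_nth (h ^ k) n\<bar> / fact k)"
    proof (rule sum_mono)
      fix n assume n: "n \<in> {..<M}"
      have "\<bar>fps_nth E n\<bar> \<le> (\<Sum>k=0..n. \<bar>fps_nth (h ^ k) n\<bar> / fact k)"
        unfolding E_def fps_compose_nth by (rule order_trans[OF sum_abs]) (simp add: abs_mult)
      also have "\<dots> \<le> (\<Sum>k<M. \<bar>fps_nth (h ^ k) n\<bar> / fact k)" using n by (intro sum_mono2) auto
      finally show "\<bar>fps_nth E n\<bar> \<le> (\<Sum>k<M. \<bar>fps_nth (h ^ k) n\<bar> / fact k)" .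
    qed
    also have "\<dots> = (\<Sum>k<M. (\<Sum>n<M. \<bar>fps_nth (h ^ k) n\<bar>) / fact k)"
      by (subst sum.swap) (simp add: sum_divide_distrib)
    also have "\<dots> \<le> (\<Sum>k<M. l1norm h ^ k / fact k)"
    proof (intro sum_mono divide_right_mono)
      fix k
      have "(\<Sum>n<M. \<bar>fps_nth (h ^ k) n\<bar>) \<le> l1norm (h ^ k)"
        unfolding l1norm_def by (rule sum_le_suminf) (use h l1_power[of h k] in \<open>auto simp: l1_def\<close>)
      also have "\<dots> \<le> l1norm h ^ k" by (rule l1norm_power_le[OF h])
      finally show "(\<Sum>n<M. \<bar>fps_nth (h ^ k) n\<bar>) \<le> l1norm h ^ k" .
    qed simp
    also have "\<dots> \<le> (\<Sum>k. l1norm h ^ k / fact k)"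
      using summable_exp_generic[of "l1norm h"] l1norm_nonneg[OF h]
      by (intro sum_le_suminf) (auto simp: field_simps)
    also have "\<dots> = exp (l1norm h)" by (simp add: exp_def field_simps)
    also have "\<dots> \<le> exp (l1norm F)" using hn by simp
    finally show ?thesis .
  qed
  have l: "summable (\<lambda>n. \<bar>fps_nth E n\<bar>)"
    by (rule bounded_imp_summable[where B = "exp (l1norm F)"])
      (use part[of "Suc _"] in \<open>auto simp: lessThan_Suc_atMost simp del: sum.lessThan_Suc\<close>)
  show thesis
  proof (rule that[OF d])
    show "fps_nth E 0 = 1" by (simp add: E_def)
    show "l1 E" using l by (simp add: l1_def)
    show "l1norm E \<le> exp (l1norm F)" unfolding l1norm_def[of E] by (rule suminf_le_const[OF l part])
  qed
qed

text \<open>For W = X^l, integrating (1 - u) u^l from 1 to z gives (1 - z)^2 times -s (1 + 2 z + ...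
  + (l + 1) z^l) with s = 1 / ((l + 1) (l + 2)), a quotient of norm exactly 1/2. \<open>J\<close> is
  the combination of these quotients with the coefficients of \<open>W\<close>.\<close>

lemma factor_integral:
  assumes T: "l1 T" "coeff_sum T = 1" and W: "l1 W" "fps_deriv T = (1 - fps_X) * W"
  obtains J where "T - 1 = (1 - fps_X) ^ 2 * J" "l1 J" "2 * l1norm J \<le> l1norm W"
proof -
  define s where "s l = fps_nth W l / (real (l + 1) * real (l + 2))" for l
  have s_le: "\<bar>s l\<bar> \<le> \<bar>fps_nth W l\<bar>" for l
  proof -
    have "1 * 1 \<le> real (l + 1) * real (l + 2)" by (intro mult_mono) auto
    from mult_left_mono[OF this, of "\<bar>fps_nth W l\<bar>"] show ?thesis
      by (simp add: s_def divide_le_eq abs_mult del: of_nat_Suc of_nat_add)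
  qed
  have ss: "summable (\<lambda>l. \<bar>s l\<bar>)"
    by (rule summable_comparison_test'[OF W(1)[unfolded l1_def], where N = 0]) (use s_le in auto)
  \<comment> \<open>This is the sum of s_l (X^(l+1) - 1), whose total is 0. Its quotient
    \<open>C\<close> by 1 - X yields \<open>J\<close> as the derivative of X C, hence the weight k +
    1 below.\<close>
  define c where "c = Abs_fps (\<lambda>l. case l of 0 \<Rightarrow> - (\<Sum>l. s l) | Suc j \<Rightarrow> s j)"
  have cS: "fps_nth c (Suc j) = s j" for j by (simp add: c_def)
  have c0: "fps_nth c 0 = - (\<Sum>l. s l)" by (simp add: c_def)
  have cl: "l1 c" unfolding l1_def by (subst summable_Suc_iff[symmetric]) (simp add: cS ss)
  have ct: "coeff_sum c = 0"
    using suminf_split_head[OF l1_summable[OF cl]] by (simp add: coeff_sum_def cS c0)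
  obtain C where C: "c = (1 - fps_X) * C"
    and w: "\<And>v :: nat \<Rightarrow> real. (\<And>k. 0 \<le> v k) \<Longrightarrow> summable (\<lambda>l. (\<Sum>k<l. v k) * \<bar>fps_nth c l\<bar>) \<Longrightarrow>
           summable (\<lambda>j. v j * \<bar>fps_nth C j\<bar>) \<and>
           (\<Sum>j. v j * \<bar>fps_nth C j\<bar>) \<le> (\<Sum>l. (\<Sum>k<l. v k) * \<bar>fps_nth c l\<bar>)"
    by (rule factor_one_minus_X[OF cl ct]) blast
  have v: "(\<Sum>k<l. real k + 1) = real l * (real l + 1) / 2" for l
    by (induction l) (auto simp: field_simps)
  have "(\<lambda>l. (\<Sum>k<Suc l. real k + 1) * \<bar>fps_nth c (Suc l)\<bar>) sums (l1norm W / 2)"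
  proof -
    have "(\<Sum>k<Suc l. real k + 1) * \<bar>fps_nth c (Suc l)\<bar> = \<bar>fps_nth W l\<bar> / 2" for l
    proof -
      define D where "D = real (l + 1) * real (l + 2)"
      have D: "0 < D" by (simp add: D_def)
      have "real (Suc l) * (real (Suc l) + 1) = D" by (simp add: D_def)
      moreover have "\<bar>s l\<bar> = \<bar>fps_nth W l\<bar> / D" unfolding s_def D_def[symmetric] using D by simp
      ultimately show ?thesis unfolding v cS using D by simp
    qed
    moreover have "(\<lambda>l. \<bar>fps_nth W l\<bar> / 2) sums (l1norm W / 2)"
      using W(1) unfolding l1_def l1norm_def by (intro sums_divide summable_sums)
    ultimately show ?thesis by (simp only:)
  qed
  hence "(\<lambda>l. (\<Sum>k<l. real k + 1) * \<bar>fps_nth c l\<bar>) sums (l1norm W / 2)"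
    by (subst (asm) sums_Suc_iff) simp
  with w[of "\<lambda>k. real k + 1"] have wC: "summable (\<lambda>j. (real j + 1) * \<bar>fps_nth C j\<bar>)"
      "(\<Sum>j. (real j + 1) * \<bar>fps_nth C j\<bar>) \<le> l1norm W / 2"
    by (auto simp: sums_iff)
  define J where "J = fps_deriv (fps_X * C)"
  have J_nth: "fps_nth J j = (real j + 1) * fps_nth C j" for j by (simp add: J_def algebra_simps)
  have Jl: "l1 J" and Jn: "2 * l1norm J \<le> l1norm W"
    using wC by (simp_all add: l1_def l1norm_def J_nth abs_mult)
  have J': "(1 - fps_X) ^ 2 * J = c + fps_X * ((1 - fps_X) * fps_deriv c)"
    unfolding J_def C power2_eq_square by (simp add: algebra_simps)
  define D where "D = (1 - fps_X) ^ 2 * J - (T - 1)"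
  have D_nth: "fps_nth D (Suc n) = 0" for n
  proof -
    have Tn: "real (Suc n) * fps_nth T (Suc n) = fps_nth W n - (if n = 0 then 0 else fps_nth W (n - 1))"
      using arg_cong[OF W(2), of "\<lambda>h. fps_nth h n"] unfolding one_minus_X_nth by simp
    have "fps_nth ((1 - fps_X) ^ 2 * J) (Suc n)
       = s n + (real (Suc n) * s n - (if n = 0 then 0 else real n * s (n - 1)))"
      unfolding J' fps_add_nth fps_X_mult_nth one_minus_X_nth by (cases n) (simp_all add: cS)
    also have "real (Suc n) * \<dots> = fps_nth W n - (if n = 0 then 0 else fps_nth W (n - 1))"
    proof -
      have e: "real (l + 1) * real (l + 2) * s l = fps_nth W l" for l
        unfolding s_def by (simp del: of_nat_add)
      show ?thesis
      proof (cases n)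
        case 0
        show ?thesis using e[of 0] by (simp add: 0)
      next
        case (Suc k)
        show ?thesis using e[of "Suc k"] e[of k] by (simp add: Suc algebra_simps)
      qed
    qed
    finally have "real (Suc n) * fps_nth ((1 - fps_X) ^ 2 * J) (Suc n) = real (Suc n) * fps_nth T (Suc n)"
      using Tn by simp
    thus ?thesis by (simp add: D_def del: of_nat_Suc)
  qed
  \<comment> \<open>All coefficients of positive degree agree; the remaining constant is found by
    evaluation at 1, where T = 1.\<close>
  have "D = fps_const (fps_nth D 0)"
  proof (rule fps_ext)
    fix n show "fps_nth D n = fps_nth (fps_const (fps_nth D 0)) n" by (cases n) (simp_all add: D_nth)
  qed
  hence "coeff_sum D = fps_nth D 0" by (metis l1_const(3))
  moreover have "coeff_sum D = 0" unfolding D_def using T Jl by simp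
  ultimately have "D = 0" using \<open>D = fps_const (fps_nth D 0)\<close> by simp
  thus thesis using that[of J] Jl Jn by (simp add: D_def)
qed

section \<open>The two comparison bounds\<close>

text \<open>Testing the negative binomial Stein equation on the set where \<open>MY\<close>
  dominates splits the distance d into the parts (MY - MV) (r q - E') and MY (E - E'). Both are
  divisible by 1 - X, and one such factor becomes an increment of \<open>g\<close>, at most 1 / (r
  q). The first part is again of order d and is absorbed on the left; in the second, two further
  factors 1 - X smooth \<open>MY\<close>.\<close>

lemma stein_perturbation_bound:
  fixes MY MV E E' D :: "real fps" and r p :: real
  defines "q \<equiv> 1 - p"
  assumes MY: "l1 MY" "coeff_sum MY = 1" "l1 (fps_deriv MY)"
    and MV: "l1 MV" "coeff_sum MV = 1" "l1 (fps_deriv MV)"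
    and EY: "(1 - fps_const q * fps_X) * fps_deriv MY = MY * E" "l1 E"
    and EV: "(1 - fps_const q * fps_X) * fps_deriv MV = MV * E'" "coeff_sum E' = r * q" "l1 (fps_deriv E')"
    and D: "E - E' = (1 - fps_X) ^ 3 * D" "l1 D"
    and r: "0 < r" and p: "0 < p" "p < 1"
  shows "l1norm (MY - MV) / 2 * (r * q - 2 * l1norm (fps_deriv E')) \<le> l1norm ((1 - fps_X) ^ 2 * MY) * l1norm D"
proof -
  have E': "l1 E'" using EV(3) by (rule l1_deriv_imp_l1)
  have q: "0 < q" using p by (simp add: q_def)
  define d where "d = l1norm (MY - MV) / 2"
  define f :: "nat \<Rightarrow> real" where "f m = (if fps_nth MY m \<ge> fps_nth MV m then 1 else 0)" for m
  obtain g c C where g: "\<And>m. (1 - p) * (r + real m) * g (m + 1) - real m * g m = f m - c"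
    and gC: "\<And>m. \<bar>g m\<bar> \<le> C"
    and gD: "\<And>m. m \<ge> 1 \<Longrightarrow> \<bar>g (m + 1) - g m\<bar> \<le> 1 / (r * (1 - p))"
    by (rule nb_stein_solution[OF r p, of f]) (auto simp: f_def)
  let ?A = "\<lambda>m. q * (r + real m) * g (m + 1) - real m * g m"
  have A: "?A m = f m - c" for m using g[of m] by (simp add: q_def)
  have Ab: "\<bar>?A m\<bar> \<le> 1 + \<bar>c\<bar>" for m
  proof -
    have "\<bar>f m\<bar> \<le> 1" by (simp add: f_def)
    thus ?thesis unfolding A by linarith
  qed
  have l: "l1 (MY - MV)" using MY MV by simp
  have sf: "summable (\<lambda>m. fps_nth P m * ?A m)" if "l1 P" for P
    using summable_l1_bounded[OF that, of ?A, OF Ab] .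
  \<comment> \<open>Both totals are 1, so the positive part of the difference has mass d and the
    constant \<open>c\<close> contributes nothing.\<close>
  have d: "d = (\<Sum>m. fps_nth (MY - MV) m * ?A m)"
  proof -
    have "(\<lambda>m. (\<bar>fps_nth (MY - MV) m\<bar> + fps_nth (MY - MV) m) / 2 - c * fps_nth (MY - MV) m)
        sums ((l1norm (MY - MV) + coeff_sum (MY - MV)) / 2 - c * coeff_sum (MY - MV))"
      unfolding l1norm_def coeff_sum_def using l l1_summable[OF l]
      by (intro sums_diff sums_divide sums_add sums_mult summable_sums) (simp_all only: l1_def)
    moreover have "(\<bar>fps_nth (MY - MV) m\<bar> + fps_nth (MY - MV) m) / 2 - c * fps_nth (MY - MV) m
        = fps_nth (MY - MV) m * ?A m" for m
    proof -
      have "(\<bar>z\<bar> + z) / 2 - c * z = z * ((if 0 \<le> z then 1 else 0) - c)" for z :: real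
        by (cases "0 \<le> z") (simp_all add: algebra_simps)
      thus ?thesis unfolding A f_def by simp
    qed
    ultimately show ?thesis using MY MV by (simp add: d_def sums_iff)
  qed
  also have "\<dots> = (\<Sum>m. fps_nth MY m * ?A m) - (\<Sum>m. fps_nth MV m * ?A m)"
    using suminf_diff[OF sf[OF MY(1)] sf[OF MV(1)]] by (simp add: left_diff_distrib)
  also have "\<dots> = pairing (MY * (fps_const (r * q) - E)) g - pairing (MV * (fps_const (r * q) - E')) g"
    using stein_identity[where g = g and r = r, OF MY(1,3) EY(2,1) gC] stein_identity[where g = g and r = r, OF MV(1,3) E' EV(1) gC] by simp
  also have "\<dots> = pairing ((MY - MV) * (fps_const (r * q) - E')) g - pairing (MY * (E - E')) g"
  proof -
    have "MY * (fps_const (r * q) - E) - MV * (fps_const (r * q) - E')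
      = (MY - MV) * (fps_const (r * q) - E') - MY * (E - E')" by (simp add: algebra_simps)
    thus ?thesis using MY MV E' EY(2) by (simp flip: pairing_diff[OF _ _ gC])
  qed
  finally have eq: "d = pairing ((MY - MV) * (fps_const (r * q) - E')) g - pairing (MY * (E - E')) g" .
  have "l1 (fps_deriv (fps_const (r * q) - E'))" "coeff_sum (fps_const (r * q) - E') = 0"
    using EV E' by simp_all
  then obtain K where K: "fps_const (r * q) - E' = (1 - fps_X) * K" "l1 K"
      "l1norm K \<le> l1norm (fps_deriv (fps_const (r * q) - E'))"
    using factor_one_minus_X_once by blast
  have K3: "l1norm K \<le> l1norm (fps_deriv E')" using K(3) by simp
  let ?B = "1 / (r * q)"
  have B: "0 < ?B" using r q by simp
  have gD': "\<And>m. m \<ge> 1 \<Longrightarrow> \<bar>g (m + 1) - g m\<bar> \<le> ?B" using gD by (simp add: q_def)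
  \<comment> \<open>The norm of \<open>MY - MV\<close> is 2 d, which is where the factor 2 in the
    conclusion comes from.\<close>
  have b1: "\<bar>pairing ((MY - MV) * (fps_const (r * q) - E')) g\<bar> \<le> (2 * d * l1norm (fps_deriv E')) * ?B"
  proof -
    have "(MY - MV) * (fps_const (r * q) - E') = (1 - fps_X) * ((MY - MV) * K)" unfolding K by (simp only: mult_ac)
    moreover have "l1 ((MY - MV) * K)" using l K(2) by simp
    ultimately have "\<bar>pairing ((MY - MV) * (fps_const (r * q) - E')) g\<bar> \<le> l1norm ((MY - MV) * K) * ?B"
      using pairing_one_minus_X[of "(MY - MV) * K" g C ?B] gC gD' by (simp only:)
    moreover have "l1norm ((MY - MV) * K) \<le> 2 * d * l1norm (fps_deriv E')"
      using l1norm_mult[OF l K(2)] mult_left_mono[OF K3 l1norm_nonneg[OF l]] by (simp add: d_def)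
    ultimately show ?thesis using mult_right_mono[of _ _ ?B] B by (meson less_imp_le order_trans)
  qed
  have b2: "\<bar>pairing (MY * (E - E')) g\<bar> \<le> (l1norm ((1 - fps_X) ^ 2 * MY) * l1norm D) * ?B"
  proof -
    have "MY * (E - E') = (1 - fps_X) * (((1 - fps_X) ^ 2 * MY) * D)"
      unfolding D power3_eq_cube power2_eq_square by (simp only: mult_ac)
    moreover have "l1 (((1 - fps_X) ^ 2 * MY) * D)" using MY D(2) by simp
    ultimately have "\<bar>pairing (MY * (E - E')) g\<bar> \<le> l1norm (((1 - fps_X) ^ 2 * MY) * D) * ?B"
      using pairing_one_minus_X[of "((1 - fps_X) ^ 2 * MY) * D" g C ?B] gC gD' by (simp only:)
    moreover have "l1norm (((1 - fps_X) ^ 2 * MY) * D) \<le> l1norm ((1 - fps_X) ^ 2 * MY) * l1norm D"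
      using MY D by (intro l1norm_mult) auto
    ultimately show ?thesis using mult_right_mono[of _ _ ?B] B by (meson less_imp_le order_trans)
  qed
  have "d \<le> (2 * d * l1norm (fps_deriv E')) * ?B + (l1norm ((1 - fps_X) ^ 2 * MY) * l1norm D) * ?B"
    using eq b1 b2 by linarith
  hence "d * (r * q) \<le> 2 * d * l1norm (fps_deriv E') + l1norm ((1 - fps_X) ^ 2 * MY) * l1norm D"
    using r q by (simp add: field_simps)
  thus ?thesis unfolding d_def by (simp add: algebra_simps)
qed

text \<open>The ratio T = MY / MV has logarithmic derivative GY - GV and T(1) = 1, so T - 1 = (1 -
  X)^2 J by \<open>factor_integral\<close>. The two factors 1 - X are spent on the two components of
  \<open>MV\<close>, whose masses decrease; this gives 2 p^\<alpha> and 2 ph. Their product is 4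
  MV(0), which cancels against the constant term MY(0) / MV(0) of T.\<close>

lemma pgf_ratio_bound:
  fixes MY D GY GV :: "real fps" and \<alpha> p ph :: real
  defines "MV \<equiv> nb_fps \<alpha> p * nb_fps 1 ph"
  assumes MY: "l1 MY" "coeff_sum MY = 1" "fps_nth MY 0 \<ge> 0"
    and dY: "fps_deriv MY = MY * GY" and dV: "fps_deriv MV = MV * GV"
    and D: "GY - GV = (1 - fps_X) ^ 3 * D * geo_fps (1 - p)" "l1 D"
    and \<alpha>: "0 < \<alpha>" "\<alpha> \<le> 1" and p: "0 < p" "p < 1" and ph: "0 < ph" "ph < 1"
  shows "l1norm (MY - MV) / 2 \<le> 4 * l1norm D * fps_nth MY 0 * exp (8 * l1norm D)"
proof -
  let ?I = "geo_fps (1 - p)"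
  define F where "F = GY - GV"
  have I: "l1 ?I" "l1norm ((1 - fps_X) * ?I) \<le> 2"
    using geo_fps_l1[of "1 - p"] l1norm_one_minus_X_geo[of "1 - p"] p by auto
  have N: "l1 (nb_fps \<alpha> p)" "l1norm ((1 - fps_X) * nb_fps \<alpha> p) \<le> 2 * p powr \<alpha>"
    using nb_fps_diff_norm[OF \<alpha>(1) p \<alpha>(2)] nb_fps_l1[OF \<alpha>(1) p] by auto
  have \<Gamma>: "l1 (nb_fps 1 ph)" "l1norm ((1 - fps_X) * nb_fps 1 ph) \<le> 2 * ph"
    using nb_fps_diff_norm[of 1 ph] nb_fps_l1[of 1 ph] ph by auto
  have MV: "l1 MV" "coeff_sum MV = 1" unfolding MV_def using \<alpha> p ph by (auto simp: nb_fps_l1)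
  have MV0: "fps_nth MV 0 = p powr \<alpha> * ph" using ph by (simp add: MV_def nb_mass_0)
  define K where "K = l1norm D"
  have K: "0 \<le> K" unfolding K_def by (rule l1norm_nonneg[OF D(2)])
  define W0 where "W0 = (1 - fps_X) * (((1 - fps_X) * ?I) * D)"
  have W0: "l1 W0" "l1norm W0 \<le> 4 * K"
  proof -
    show "l1 W0" unfolding W0_def using I D by simp
    have "l1norm W0 \<le> l1norm (1 - fps_X) * l1norm (((1 - fps_X) * ?I) * D)"
      unfolding W0_def using I D by (intro l1norm_mult) auto
    also have "\<dots> \<le> l1norm (1 - fps_X) * (l1norm ((1 - fps_X) * ?I) * K)"
      unfolding K_def using I D by (intro mult_left_mono l1norm_mult l1norm_nonneg) auto
    also have "\<dots> \<le> 2 * (2 * K)"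
      using l1norm_one_minus_X I K by (intro mult_mono mult_nonneg_nonneg l1norm_nonneg) auto
    finally show "l1norm W0 \<le> 4 * K" by simp
  qed
  have F: "F = (1 - fps_X) * W0"
    unfolding F_def D W0_def power3_eq_cube by (simp only: mult_ac)
  have Fl: "l1 F" unfolding F using W0 by simp
  have Fn: "l1norm F \<le> 8 * K"
  proof -
    have "l1norm F \<le> l1norm (1 - fps_X) * l1norm W0" unfolding F using W0 by (intro l1norm_mult) auto
    also have "\<dots> \<le> 2 * (4 * K)" using l1norm_one_minus_X W0 by (intro mult_mono l1norm_nonneg) auto
    finally show ?thesis by simp
  qed
  obtain E where E: "fps_deriv E = E * F" "fps_nth E 0 = 1" "l1 E" "l1norm E \<le> exp (l1norm F)"
    using fps_exp_integral[OF Fl] by blast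
  define c where "c = fps_nth MY 0 / fps_nth MV 0"
  have c: "0 \<le> c" using MY(3) MV0 p ph by (simp add: c_def)
  define T where "T = fps_const c * E"
  have T: "l1 T" "fps_deriv T = T * F" "l1norm T \<le> c * exp (8 * K)"
  proof -
    show "l1 T" "fps_deriv T = T * F" using E by (simp_all add: T_def mult.assoc)
    have "l1norm E \<le> exp (8 * K)" using E(4) Fn by (meson exp_le_cancel_iff order_trans)
    thus "l1norm T \<le> c * exp (8 * K)" using E(3) c by (simp add: T_def l1norm_const_mult mult_left_mono)
  qed
  have MYT: "MY = MV * T"
  proof (rule fps_log_deriv_unique[OF dY])
    show "fps_deriv (MV * T) = MV * T * GY"
      unfolding fps_deriv_mult dV T(2) F_def by (simp add: algebra_simps)
    show "fps_nth MY 0 = fps_nth (MV * T) 0" using MV0 p ph E(2) by (simp add: T_def c_def)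
  qed
  have Tt: "coeff_sum T = 1" using MY(2) MV T(1) by (simp add: MYT)
  have "fps_deriv T = (1 - fps_X) * (W0 * T)" unfolding T(2) F by (simp only: mult_ac)
  moreover have "l1 (W0 * T)" using W0 T by simp
  ultimately obtain J where J: "T - 1 = (1 - fps_X) ^ 2 * J" "l1 J" "2 * l1norm J \<le> l1norm (W0 * T)"
    using factor_integral[OF T(1) Tt] by blast
  have Jn: "l1norm J \<le> 2 * K * (c * exp (8 * K))"
  proof -
    have "l1norm (W0 * T) \<le> l1norm W0 * l1norm T" using W0 T by (intro l1norm_mult)
    also have "\<dots> \<le> (4 * K) * (c * exp (8 * K))"
      using W0 T K by (intro mult_mono l1norm_nonneg) auto
    finally show ?thesis using J(3) by simp
  qed
  have "MY - MV = MV * (T - 1)" unfolding MYT by (simp add: algebra_simps)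
  also have "\<dots> = ((1 - fps_X) * nb_fps \<alpha> p) * (((1 - fps_X) * nb_fps 1 ph) * J)"
    unfolding J MV_def power2_eq_square by (simp only: mult_ac)
  finally have "l1norm (MY - MV) \<le> l1norm ((1 - fps_X) * nb_fps \<alpha> p) * l1norm (((1 - fps_X) * nb_fps 1 ph) * J)"
    using N \<Gamma> J by (simp add: l1norm_mult)
  also have "\<dots> \<le> l1norm ((1 - fps_X) * nb_fps \<alpha> p) * (l1norm ((1 - fps_X) * nb_fps 1 ph) * l1norm J)"
    using N \<Gamma> J by (intro mult_left_mono l1norm_mult l1norm_nonneg) auto
  also have "\<dots> \<le> (2 * p powr \<alpha>) * ((2 * ph) * (2 * K * (c * exp (8 * K))))"
    using N \<Gamma> J Jn p ph by (intro mult_mono mult_nonneg_nonneg l1norm_nonneg) auto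
  also have "\<dots> = 8 * K * (c * fps_nth MV 0) * exp (8 * K)" by (simp add: MV0)
  also have "c * fps_nth MV 0 = fps_nth MY 0" using MV0 p ph by (simp add: c_def)
  finally show ?thesis by (simp add: K_def)
qed

lemma dtv_fps: "dtv (fps_nth f) (fps_nth g) = l1norm (f - g) / 2"
  by (simp add: dtv_def l1norm_def)

lemma fps_prod_log_deriv:
  fixes P G :: "nat \<Rightarrow> real fps"
  assumes "\<And>i. i \<in> {1..n} \<Longrightarrow> fps_deriv (P i) = P i * G i"
  shows "fps_deriv (\<Prod>i=1..n. P i) = (\<Prod>i=1..n. P i) * (\<Sum>i=1..n. G i)"
  using assms by (induction n) (simp_all add: algebra_simps)

lemma fps_nth_0_prod: "fps_nth (prod f I) 0 = (\<Prod>i\<in>I. fps_nth (f i) 0)" for f :: "'a \<Rightarrow> real fps"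
  by (induction I rule: infinite_finite_induct) auto

lemma real_choose_3: "real (l choose 3) = real l * (real l - 1) * (real l - 2) / 6"
proof -
  have 2: "real (l choose 2) = real l * (real l - 1) / 2" for l
    by (induction l) (simp_all add: numeral_2_eq_2 field_simps)
  show ?thesis
  proof (induction l)
    case (Suc l)
    have "Suc l choose 3 = (l choose 2) + (l choose 3)" by (simp add: numeral_3_eq_3 numeral_2_eq_2)
    thus ?case using Suc by (simp add: 2 field_simps)
  qed (simp add: binomial_eq_0)
qed

section \<open>Matching of the parameters\<close>

text \<open>The cube of \<eta>3 solves the resolvent w^2 - \<eta>2 w - \<eta>1^3 = 0, to which the
  cubic reduces by t \<eta>3 = \<eta>1 - \<eta>3^2. The second claim, a perfect square, says that
  the other two roots of the cubic are not distinct reals.\<close>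

lemma cardano_root:
  fixes \<eta>1 \<eta>2 \<eta>3 :: real
  assumes disc: "4 * \<eta>1 ^ 3 + \<eta>2 ^ 2 \<ge> 0"
    and eta3: "\<eta>3 = root 3 ((\<eta>2 + sqrt (4 * \<eta>1 ^ 3 + \<eta>2 ^ 2)) / 2)" "\<eta>3 > 0"
  defines "t \<equiv> \<eta>1 / \<eta>3 - \<eta>3"
  shows "t ^ 3 + 3 * \<eta>1 * t + \<eta>2 = 0" "t ^ 2 + 4 * \<eta>1 \<ge> 0"
proof -
  define S where "S = sqrt (4 * \<eta>1 ^ 3 + \<eta>2 ^ 2)"
  have S: "S ^ 2 = 4 * \<eta>1 ^ 3 + \<eta>2 ^ 2" using disc by (simp add: S_def)
  have w: "\<eta>3 ^ 3 = (\<eta>2 + S) / 2" by (simp add: eta3(1) S_def odd_real_root_pow)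
  have "4 * ((\<eta>3 ^ 3) ^ 2 - \<eta>2 * \<eta>3 ^ 3 - \<eta>1 ^ 3) = S ^ 2 - (4 * \<eta>1 ^ 3 + \<eta>2 ^ 2)"
    unfolding w by (simp add: power2_eq_square field_simps)
  hence w2: "(\<eta>3 ^ 3) ^ 2 - \<eta>2 * \<eta>3 ^ 3 - \<eta>1 ^ 3 = 0" using S by simp
  have t: "t * \<eta>3 = \<eta>1 - \<eta>3 ^ 2" using eta3(2) by (simp add: t_def field_simps power2_eq_square)
  have "(t ^ 3 + 3 * \<eta>1 * t + \<eta>2) * \<eta>3 ^ 3 = (t * \<eta>3) ^ 3 + 3 * \<eta>1 * (t * \<eta>3) * \<eta>3 ^ 2 + \<eta>2 * \<eta>3 ^ 3"
    by (simp add: algebra_simps power2_eq_square power3_eq_cube)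
  also have "\<dots> = - ((\<eta>3 ^ 3) ^ 2 - \<eta>2 * \<eta>3 ^ 3 - \<eta>1 ^ 3)"
    unfolding t by (simp add: algebra_simps power2_eq_square power3_eq_cube)
  finally have "(t ^ 3 + 3 * \<eta>1 * t + \<eta>2) * \<eta>3 ^ 3 = 0" using w2 by simp
  thus "t ^ 3 + 3 * \<eta>1 * t + \<eta>2 = 0" using eta3(2) by simp
  have "t ^ 2 + 4 * \<eta>1 = (\<eta>1 / \<eta>3 + \<eta>3) ^ 2" using eta3(2) by (simp add: t_def field_simps power2_eq_square)
  thus "t ^ 2 + 4 * \<eta>1 \<ge> 0" by simp
qed

text \<open>Here x = \<eta> / (3 \<mu>), and the formulas for \<alpha> and p solve the first two
  matching equations. With t = 3 \<mu> x - 2 \<mu>2 the cubic of \<open>cardano_root\<close> is 27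
  \<mu>^2 times the third, cleared of denominators; the last claim is t^2 + 4 \<eta>1 >= 0 divided
  by 3 x.\<close>

lemma cumulant_matching:
  fixes \<mu> \<sigma>2 \<mu>2 \<mu>3 \<eta>1 \<eta>2 \<eta>3 \<eta> ph \<alpha> p :: real
  assumes sigma: "\<sigma>2 = \<mu>2 + \<mu>" and mu: "\<mu> > 0"
    and eta1_def: "\<eta>1 = 3/2 * \<mu> * \<mu>3 - 4 * \<mu>2 ^ 2"
    and eta2_def: "\<eta>2 = 27 * \<mu>^2 * \<mu>2^2 - 16 * \<mu>2^3 - 27/2 * \<mu>^3 * \<mu>3 + 9 * \<mu> * \<mu>2 * \<mu>3"
    and disc: "4 * \<eta>1 ^ 3 + \<eta>2 ^ 2 \<ge> 0"
    and eta3_def: "\<eta>3 = root 3 ((\<eta>2 + sqrt (4 * \<eta>1 ^ 3 + \<eta>2 ^ 2)) / 2)"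
    and eta_def: "\<eta> = 2 * \<mu>2 + \<eta>1 / \<eta>3 - \<eta>3"
    and eta3_pos: "\<eta>3 > 0" and eta_pos: "\<eta> > 0"
    and ph_def: "ph = 3 * \<mu> / (3 * \<mu> + \<eta>)"
    and alpha_def: "\<alpha> = (\<mu> - \<eta> / (3 * \<mu>))^2 / (\<mu>2 - \<eta>^2 / (9 * \<mu>^2))"
    and p_def: "p = (\<mu> - \<eta> / (3 * \<mu>)) / (\<sigma>2 - \<eta> / (3 * \<mu>) * (\<eta> / (3 * \<mu>) + 1))"
    and alpha_pos: "\<alpha> > 0"
    and p_range: "0 < p" "p < 1"
  defines "x \<equiv> (1 - ph) / ph" and "y \<equiv> (1 - p) / p" and "A \<equiv> \<alpha> * ((1 - p) / p)"
  shows "\<mu> = A + x" "\<mu>2 = A * y + x ^ 2" "\<mu>3 = 2 * (A * y ^ 2 + x ^ 3)"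
    "A ^ 2 * (3 * x - 4 * y) + A * (6 * x ^ 2 - 12 * x * y + 4 * y ^ 2) - x ^ 3 \<ge> 0"
proof -
  have "1 - ph = \<eta> / (3 * \<mu> + \<eta>)" using mu eta_pos by (simp add: ph_def field_simps)
  hence x: "x = \<eta> / (3 * \<mu>)" using mu eta_pos by (simp add: x_def ph_def)
  have x0: "0 < x" using x mu eta_pos by simp
  have eta: "\<eta> = 3 * \<mu> * x" using x mu by simp
  have a: "\<alpha> = (\<mu> - x) ^ 2 / (\<mu>2 - x ^ 2)"
    unfolding alpha_def x power_divide power_mult_distrib by simp
  \<comment> \<open>The numerator of \<alpha> is a square, so \<alpha> > 0 makes it nonzero and the
    denominator positive.\<close>
  have d: "0 < \<mu>2 - x ^ 2" and ne: "\<mu> - x \<noteq> 0"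
    using alpha_pos unfolding a by (auto simp: zero_less_divide_iff)
  have "p = (\<mu> - x) / (\<sigma>2 - x * (x + 1))" unfolding p_def x ..
  also have "\<sigma>2 - x * (x + 1) = (\<mu>2 - x ^ 2) + (\<mu> - x)" by (simp add: sigma power2_eq_square algebra_simps)
  finally have p: "p = (\<mu> - x) / ((\<mu>2 - x ^ 2) + (\<mu> - x))" .
  have "(\<mu>2 - x ^ 2) + (\<mu> - x) \<noteq> 0" using p p_range by auto
  moreover have "v + u \<noteq> 0 \<Longrightarrow> 1 - u / (v + u) = v / (v + u)" for u v :: real by (simp add: field_simps)
  ultimately have y: "y = (\<mu>2 - x ^ 2) / (\<mu> - x)" unfolding y_def p by simp
  have Ad: "A = \<alpha> * y" by (simp add: A_def y_def)
  have A: "A = \<mu> - x" unfolding Ad a y using ne d by (simp add: power2_eq_square)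
  show 1: "\<mu> = A + x" using A by simp
  show 2: "\<mu>2 = A * y + x ^ 2" unfolding A y using ne by simp
  define t where "t = \<eta>1 / \<eta>3 - \<eta>3"
  have t: "t = 3 * \<mu> * x - 2 * \<mu>2" using eta_def eta by (simp add: t_def)
  have c: "t ^ 3 + 3 * \<eta>1 * t + \<eta>2 = 0" "t ^ 2 + 4 * \<eta>1 \<ge> 0"
    unfolding t_def by (rule cardano_root[OF disc eta3_def eta3_pos])+
  have "t ^ 3 + 3 * \<eta>1 * t + \<eta>2 = 27 * \<mu> ^ 2 * ((\<mu>2 - x ^ 2) ^ 2 - (\<mu> - x) * (\<mu>3 / 2 - x ^ 3))"
    unfolding t eta1_def eta2_def by (simp add: field_simps power2_eq_square power3_eq_cube)
  hence "(\<mu>2 - x ^ 2) ^ 2 = (\<mu> - x) * (\<mu>3 / 2 - x ^ 3)" using c(1) mu by simp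
  moreover have "w = u * (v / u) ^ 2" if "v ^ 2 = u * w" "u \<noteq> 0" for u v w :: real
    unfolding power_divide that(1) using that(2) by (simp add: power2_eq_square)
  ultimately have "\<mu>3 / 2 - x ^ 3 = A * y ^ 2" unfolding A y using ne by blast
  thus 3: "\<mu>3 = 2 * (A * y ^ 2 + x ^ 3)" by simp
  have "t ^ 2 + 4 * \<eta>1 = 3 * x * (A ^ 2 * (3 * x - 4 * y) + A * (6 * x ^ 2 - 12 * x * y + 4 * y ^ 2) - x ^ 3)"
    unfolding t eta1_def 3 2 1 by (simp add: field_simps power2_eq_square power3_eq_cube)
  with c(2) x0 show "A ^ 2 * (3 * x - 4 * y) + A * (6 * x ^ 2 - 12 * x * y + 4 * y ^ 2) - x ^ 3 \<ge> 0"
    by (simp add: zero_le_mult_iff)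
qed

text \<open>Moving x^3 > 0 aside and dividing by A leaves an inequality linear in A. With x^2 <= x y
  it becomes (A + x) (4 y - 3 x) <= y (4 y - 3 x), where 4 y - 3 x > 0.\<close>

lemma discriminant_bound:
  fixes A x y :: real
  assumes "0 < A" "0 < x" "x < y"
    and D: "A ^ 2 * (3 * x - 4 * y) + A * (6 * x ^ 2 - 12 * x * y + 4 * y ^ 2) - x ^ 3 \<ge> 0"
  shows "A + x \<le> y"
proof -
  have "0 < x ^ 3" using assms by simp
  moreover have "A * (A * (3 * x - 4 * y) + (6 * x ^ 2 - 12 * x * y + 4 * y ^ 2)) =
      (A ^ 2 * (3 * x - 4 * y) + A * (6 * x ^ 2 - 12 * x * y + 4 * y ^ 2) - x ^ 3) + x ^ 3"
    by (simp add: algebra_simps power2_eq_square)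
  ultimately have "0 \<le> A * (A * (3 * x - 4 * y) + (6 * x ^ 2 - 12 * x * y + 4 * y ^ 2))"
    using D by linarith
  hence "0 \<le> A * (3 * x - 4 * y) + (6 * x ^ 2 - 12 * x * y + 4 * y ^ 2)"
    using assms by (simp add: zero_le_mult_iff)
  moreover have "x * x \<le> x * y" using assms by simp
  moreover have "0 \<le> x * y" using assms by simp
  ultimately have "(A + x) * (4 * y - 3 * x) \<le> y * (4 * y - 3 * x)"
    by (simp add: algebra_simps power2_eq_square)
  thus ?thesis using assms by (simp add: mult_le_cancel_right)
qed

text \<open>Division by 1 - q X is multiplication by a geometric series with absolutely summable
  derivatives, so the weighted error series controls the logarithmic derivative itself.\<close>

lemma l1_log_deriv:
  assumes q: "0 \<le> q" "q < 1" and E: "l1 (fps_deriv (fps_deriv (fps_deriv ((1 - fps_const q * fps_X) * G))))"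
  shows "l1 G" "l1 (fps_deriv G)" "l1 (fps_deriv (fps_deriv G))"
proof -
  let ?E = "(1 - fps_const q * fps_X) * G"
  define E0 where "E0 = ?E"
  have l: "l1 (fps_deriv (fps_deriv E0))" "l1 (fps_deriv E0)" "l1 E0"
    using E l1_deriv_imp_l1 unfolding E0_def by blast+
  have I: "l1 (geo_fps q)" using q by simp
  have "G = ((1 - fps_const q * fps_X) * geo_fps q) * G" by (simp add: geo_fps_inverse)
  hence G: "G = E0 * geo_fps q" unfolding E0_def by (simp only: mult_ac)
  have dG: "fps_deriv G = E0 * (fps_const q * geo_fps q ^ 2) + fps_deriv E0 * geo_fps q"
    unfolding G by (simp add: geo_fps_deriv)
  show "l1 G" unfolding G using l I by simp
  show "l1 (fps_deriv G)" unfolding dG using l I by simp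
  show "l1 (fps_deriv (fps_deriv G))" unfolding dG using l I
    by (simp add: geo_fps_deriv fps_deriv_power)
qed

lemma geo_fps_deriv2: "fps_deriv (fps_deriv (geo_fps q)) = fps_const (2 * q ^ 2) * geo_fps q ^ 3"
  unfolding geo_fps_deriv
  by (simp add: fps_deriv_power geo_fps_deriv power2_eq_square power3_eq_cube mult_ac flip: fps_const_mult)

lemma geo_fps_deriv3: "fps_deriv (fps_deriv (fps_deriv (geo_fps q))) = fps_const (6 * q ^ 3) * geo_fps q ^ 4"
  unfolding geo_fps_deriv2
  by (simp add: fps_deriv_power geo_fps_deriv power2_eq_square power3_eq_cube mult_ac flip: fps_const_mult)
    (simp add: eval_nat_numeral mult_ac)

text \<open>The overlap is at most P(X >= 1), hence at most the mean, which is G(1) because the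
  generating function is 1 there. Summed over i this yields \<Psi> <= \<mu>.\<close>

lemma overlap_le_mean:
  assumes "fps_deriv (pgf_fps X) = pgf_fps X * G" "l1 G"
  shows "l1 (fps_deriv (pgf_fps X))" "overlap X \<le> coeff_sum G"
proof -
  show l: "l1 (fps_deriv (pgf_fps X))" using assms by simp
  have p: "(\<lambda>m. pmf X (Suc m)) sums (1 - pmf X 0)" using sums_Suc_iff[of "pmf X"] pmf_nat_sums[of X] by simp
  have m: "(\<lambda>m. fps_nth (fps_deriv (pgf_fps X)) m) sums coeff_sum (fps_deriv (pgf_fps X))"
    unfolding coeff_sum_def by (rule summable_sums[OF l1_summable[OF l]])
  have "1 - pmf X 0 \<le> coeff_sum (fps_deriv (pgf_fps X))"
    by (rule sums_le[OF _ p m]) (simp add: distrib_right)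
  also have "\<dots> = coeff_sum G" using assms by simp
  finally show "overlap X \<le> coeff_sum G" using overlap_le[of X] by simp
qed

section \<open>The approximation bound\<close>

theorem theorem3p3:
  fixes n :: nat and X :: "nat \<Rightarrow> nat pmf" and a :: "nat \<Rightarrow> nat \<Rightarrow> real"
    and \<mu> \<sigma>2 \<mu>2 \<mu>3 \<eta>1 \<eta>2 \<eta>3 \<eta> ph \<alpha> p q qh r \<Psi> :: real
  assumes G: "\<And>i. i \<in> {1..n} \<Longrightarrow>
      fps_deriv (pgf_fps (X i)) = pgf_fps (X i) * Abs_fps (\<lambda>m. a i (m + 1))"
    and summ: "\<And>i. i \<in> {1..n} \<Longrightarrow> summable (\<lambda>m. a i (m + 1))
          \<and> summable (\<lambda>m. real (m + 1) * a i (m + 1))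
          \<and> summable (\<lambda>m. real m * a i (m + 1))
          \<and> summable (\<lambda>m. real m * (real m - 1) * a i (m + 1))"
    and mu_def: "\<mu> = (\<Sum>i=1..n. \<Sum>m. a i (m + 1))"
    and sigma2_def: "\<sigma>2 = (\<Sum>i=1..n. \<Sum>m. real (m + 1) * a i (m + 1))"
    and mu2_def: "\<mu>2 = (\<Sum>i=1..n. \<Sum>m. real m * a i (m + 1))"
    and mu3_def: "\<mu>3 = (\<Sum>i=1..n. \<Sum>m. real m * (real m - 1) * a i (m + 1))"
    and var: "\<sigma>2 > \<mu>"
    and eta1_def: "\<eta>1 = 3/2 * \<mu> * \<mu>3 - 4 * \<mu>2 ^ 2"
    and eta2_def: "\<eta>2 = 27 * \<mu>^2 * \<mu>2^2 - 16 * \<mu>2^3 - 27/2 * \<mu>^3 * \<mu>3 + 9 * \<mu> * \<mu>2 * \<mu>3"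
    and disc: "4 * \<eta>1 ^ 3 + \<eta>2 ^ 2 \<ge> 0"
    and eta3_def: "\<eta>3 = root 3 ((\<eta>2 + sqrt (4 * \<eta>1 ^ 3 + \<eta>2 ^ 2)) / 2)"
    and eta_def: "\<eta> = 2 * \<mu>2 + \<eta>1 / \<eta>3 - \<eta>3"
    and eta3_pos: "\<eta>3 > 0" and eta_pos: "\<eta> > 0"
    and ph_def: "ph = 3 * \<mu> / (3 * \<mu> + \<eta>)"
    and alpha_def: "\<alpha> = (\<mu> - \<eta> / (3 * \<mu>))^2 / (\<mu>2 - \<eta>^2 / (9 * \<mu>^2))"
    and p_def: "p = (\<mu> - \<eta> / (3 * \<mu>)) / (\<sigma>2 - \<eta> / (3 * \<mu>) * (\<eta> / (3 * \<mu>) + 1))"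
    and alpha_pos: "\<alpha> > 0"
    and p_range: "0 < p" "p < 1" and ph_range: "0 < ph" "ph < 1"
    and q_def: "q = 1 - p" and qh_def: "qh = 1 - ph"
    and r_def: "r = \<alpha> + 1 + (qh - q) / (q * ph)"
    and Psi_def: "\<Psi> = (\<Sum>i=1..n. min (1/2) (1 - dtv (pmf (X i)) (shift1 (pmf (X i)))))"
    and Psi_pos: "\<Psi> > 0"
    and summ_err: "\<And>i. i \<in> {1..n} \<Longrightarrow>
          summable (\<lambda>l. real l * (real l - 1) * (real l - 2) / 6 * \<bar>a i (l + 1) - q * a i l\<bar>)"
    and cond: "r * q > \<bar>qh - q\<bar> * qh / ph ^ 2"
  shows "dtv (sum_law X n) (conv (nb_mass \<alpha> p) (geo_mass ph))
    \<le> 16 / (\<Psi> * (r * q - \<bar>qh - q\<bar> * qh / ph ^ 2))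
       * ((\<Sum>i=1..n. \<Sum>l. real l * (real l - 1) * (real l - 2) / 6 * \<bar>a i (l + 1) - q * a i l\<bar>)
          + \<bar>qh - q\<bar> * qh ^ 3 / ph ^ 4)"
proof -

  \<comment> \<open>Logarithmic derivative of Y and its values at 1\<close>
  have q: "0 < q" "q < 1" "p = 1 - q" and qh: "0 < qh" "qh < 1" "ph = 1 - qh"
    using p_range ph_range by (simp_all add: q_def qh_def)
  define P where "P i = pgf_fps (X i)" for i
  define Gf where "Gf i = Abs_fps (\<lambda>m. a i (m + 1))" for i
  define MY where "MY = (\<Prod>i=1..n. P i)"
  define GY where "GY = (\<Sum>i=1..n. Gf i)"
  define S where "S i = (\<Sum>l. real l * (real l - 1) * (real l - 2) / 6 * \<bar>a i (l + 1) - q * a i l\<bar>)" for i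
  let ?L = "1 - fps_const q * fps_X"
  have PG: "fps_deriv (P i) = P i * Gf i" if "i \<in> {1..n}" for i
    using G[OF that] by (simp add: P_def Gf_def)
  have E3: "l1 (fps_deriv (fps_deriv (fps_deriv (?L * Gf i))))"
      "l1norm (fps_deriv (fps_deriv (fps_deriv (?L * Gf i)))) = 6 * S i" if i: "i \<in> {1..n}" for i
  proof -
    \<comment> \<open>At l = 0 the coefficient is \<open>a i 1\<close>, without the term
      \<open>q * a i 0\<close>, but the weight vanishes there.\<close>
    have "real (l choose 3) * \<bar>fps_nth (?L * Gf i) l\<bar>
        = real l * (real l - 1) * (real l - 2) / 6 * \<bar>a i (l + 1) - q * a i l\<bar>" for l
      unfolding real_choose_3 fps_const_X_nth by (cases l) (simp_all add: Gf_def)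
    hence "(\<lambda>l. real (l choose 3) * \<bar>fps_nth (?L * Gf i) l\<bar>) sums S i"
      unfolding S_def using summable_sums[OF summ_err[OF i]] by (simp only:)
    thus "l1 (fps_deriv (fps_deriv (fps_deriv (?L * Gf i))))"
      "l1norm (fps_deriv (fps_deriv (fps_deriv (?L * Gf i)))) = 6 * S i"
      unfolding l1_deriv3_sums l1_def l1norm_def by (auto simp only: sums_iff)
  qed
  have Gl: "l1 (Gf i)" "l1 (fps_deriv (Gf i))" "l1 (fps_deriv (fps_deriv (Gf i)))" if "i \<in> {1..n}" for i
    using l1_log_deriv[OF _ q(2) E3(1)[OF that]] q by auto
  have Gt: "coeff_sum (Gf i) = (\<Sum>m. a i (m + 1))"
      "coeff_sum (fps_deriv (Gf i)) = (\<Sum>m. real m * a i (m + 1))"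
      "coeff_sum (fps_deriv (fps_deriv (Gf i))) = (\<Sum>m. real m * (real m - 1) * a i (m + 1))"
    if i: "i \<in> {1..n}" for i
  proof -
    show "coeff_sum (Gf i) = (\<Sum>m. a i (m + 1))" by (simp add: coeff_sum_def Gf_def)
    have s: "summable (\<lambda>m. real m * a i (m + 1))" "summable (\<lambda>m. real m * (real m - 1) * a i (m + 1))"
      using summ[OF i] by auto
    show "coeff_sum (fps_deriv (Gf i)) = (\<Sum>m. real m * a i (m + 1))"
      using suminf_split_head[OF s(1)] by (simp add: coeff_sum_def Gf_def)
    have "(\<Sum>m. real m * (real m - 1) * a i (m + 1))
        = (\<Sum>m. real (m + 2) * (real (m + 2) - 1) * a i (m + 2 + 1))"
      using suminf_split_initial_segment[OF s(2), of 2] by (simp add: numeral_2_eq_2)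
    thus "coeff_sum (fps_deriv (fps_deriv (Gf i))) = (\<Sum>m. real m * (real m - 1) * a i (m + 1))"
      by (simp add: coeff_sum_def Gf_def numeral_2_eq_2 mult_ac add_ac)
  qed
  have GYl: "l1 GY" "l1 (fps_deriv GY)" "l1 (fps_deriv (fps_deriv GY))"
    unfolding GY_def fps_deriv_sum by (rule l1_sum, erule Gl)+
  have GYt: "coeff_sum GY = \<mu>" "coeff_sum (fps_deriv GY) = \<mu>2" "coeff_sum (fps_deriv (fps_deriv GY)) = \<mu>3"
    unfolding GY_def fps_deriv_sum mu_def mu2_def mu3_def
    by (rule trans[OF coeff_sum_sum sum.cong[OF refl]], erule Gl, erule Gt)+
  have sigma: "\<sigma>2 = \<mu>2 + \<mu>"
  proof -
    have "(\<Sum>m. real (m + 1) * a i (m + 1)) = (\<Sum>m. real m * a i (m + 1)) + (\<Sum>m. a i (m + 1))" if "i \<in> {1..n}" for i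
      using suminf_add[of "\<lambda>m. real m * a i (m + 1)" "\<lambda>m. a i (m + 1)"] summ[OF that] by (simp add: algebra_simps)
    thus ?thesis unfolding sigma2_def mu2_def mu_def by (simp add: sum.distrib)
  qed

  \<comment> \<open>Overlap sum and the parameters in the coordinates x, y, A\<close>
  define \<Lambda> where "\<Lambda> = (\<Sum>i=1..n. overlap (X i))"
  have Psi_le: "\<Psi> \<le> \<Lambda>" unfolding Psi_def \<Lambda>_def overlap_def by (intro sum_mono) simp
  have PD: "l1 (fps_deriv (P i))" "overlap (X i) \<le> coeff_sum (Gf i)" if "i \<in> {1..n}" for i
    using overlap_le_mean[of "X i" "Gf i"] PG[OF that] Gl[OF that] by (auto simp: P_def)
  have "\<Lambda> \<le> (\<Sum>i=1..n. coeff_sum (Gf i))" unfolding \<Lambda>_def using PD by (intro sum_mono) auto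
  also have "\<dots> = \<mu>" unfolding GYt(1)[symmetric] GY_def by (rule coeff_sum_sum[OF Gl(1), symmetric])
  finally have Lam_le: "\<Lambda> \<le> \<mu>" .
  have mu: "0 < \<mu>" using Psi_pos Psi_le Lam_le by simp

  define x where "x = qh / ph"
  define y where "y = q / p"
  define A where "A = \<alpha> * (q / p)"
  note cm = cumulant_matching[OF sigma mu eta1_def eta2_def disc eta3_def eta_def eta3_pos eta_pos ph_def
      alpha_def p_def alpha_pos p_range, folded q_def qh_def, folded x_def y_def A_def]
  have pos: "0 < x" "0 < y" "0 < A"
    using q qh p_range ph_range alpha_pos by (simp_all add: x_def y_def A_def)
  have qy: "q = p * y" using p_range by (simp add: y_def)
  have aq: "\<alpha> * q = p * A" using p_range by (simp add: A_def)
  have iph: "1 / ph = 1 + x" using ph_range by (simp add: x_def qh_def field_simps)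
  have diff: "(qh - q) / ph = p * (x - y)"
  proof -
    have "(qh - q) / ph = x - q * (1 / ph)" by (simp add: x_def diff_divide_distrib)
    also have "\<dots> = x * (1 - q) - q" unfolding iph by (simp add: algebra_simps)
    also have "\<dots> = x * p - p * y" unfolding q(3)[symmetric] qy[symmetric] ..
    also have "\<dots> = p * (x - y)" by (simp add: algebra_simps)
    finally show ?thesis .
  qed
  have rq': "r * q = \<alpha> * q + q + (qh - q) / ph"
    unfolding r_def distrib_right using q(1) by simp
  \<comment> \<open>The three summands are p A, p y and p (x - y), with total p (A + x).\<close>
  have rq: "r * q = p * \<mu>"
    unfolding rq' diff aq cm(1) by (simp add: distrib_left right_diff_distrib flip: qy)
  have rpos: "0 < r" using rq mu p_range q by (metis zero_less_mult_pos2 mult_pos_pos)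
  define \<gamma> where "\<gamma> = \<bar>qh - q\<bar> * qh / ph ^ 2"
  have gam: "\<gamma> = p * \<bar>x - y\<bar> * x"
  proof -
    have "\<gamma> = \<bar>(qh - q) / ph\<bar> * x" using ph_range by (simp add: \<gamma>_def x_def power2_eq_square abs_divide)
    thus ?thesis unfolding diff using p_range by (simp add: abs_mult)
  qed
  have gam0: "0 \<le> \<gamma>" unfolding gam using p_range pos by simp
  define K where "K = (\<Sum>i=1..n. S i) + \<bar>qh - q\<bar> * qh ^ 3 / ph ^ 4"
  have K0: "\<bar>qh - q\<bar> * qh ^ 3 / ph ^ 4 = \<gamma> * x ^ 2"
    by (simp add: \<gamma>_def x_def power_divide eval_nat_numeral)
  have S0: "0 \<le> S i" if "i \<in> {1..n}" for i using E3[OF that] l1norm_nonneg by fastforce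
  have KS: "\<gamma> * x ^ 2 \<le> K" unfolding K_def K0 using sum_nonneg[of "{1..n}" S, OF S0] by simp
  have Knn: "0 \<le> K" using KS gam0 by (smt (verit) mult_nonneg_nonneg zero_le_power2)

  \<comment> \<open>Generating function of V and its Stein operator\<close>
  define MV where "MV = nb_fps \<alpha> p * nb_fps 1 ph"
  define GV where "GV = fps_const (\<alpha> * q) * geo_fps q + fps_const qh * geo_fps qh"
  have geo: "l1 (geo_fps q)" "coeff_sum (geo_fps q) = 1 / p" "l1 (geo_fps qh)" "coeff_sum (geo_fps qh) = 1 / ph"
    using q qh by simp_all
  have MVl: "l1 MV" "coeff_sum MV = 1"
    unfolding MV_def using nb_fps_l1[OF alpha_pos p_range] nb_fps_l1[OF _ ph_range, of 1] by simp_all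
  have dMV: "fps_deriv MV = MV * GV"
    unfolding MV_def GV_def fps_deriv_mult nb_fps_deriv[OF alpha_pos p_range] nb_fps_deriv[OF zero_less_one ph_range]
    by (simp add: q_def[symmetric] qh_def[symmetric] algebra_simps)
  have dGV: "fps_deriv GV = fps_const (\<alpha> * q * q) * geo_fps q ^ 2 + fps_const (qh * qh) * geo_fps qh ^ 2"
    by (simp add: GV_def geo_fps_deriv mult.assoc[symmetric])
  have d2GV: "fps_deriv (fps_deriv GV) =
      fps_const (\<alpha> * q * (2 * q ^ 2)) * geo_fps q ^ 3 + fps_const (qh * (2 * qh ^ 2)) * geo_fps qh ^ 3"
  proof -
    have "fps_deriv (fps_deriv GV) =
        fps_const (\<alpha> * q) * fps_deriv (fps_deriv (geo_fps q)) + fps_const qh * fps_deriv (fps_deriv (geo_fps qh))"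
      by (simp add: GV_def)
    thus ?thesis unfolding geo_fps_deriv2 by (simp add: mult.assoc[symmetric])
  qed
  have GVl: "l1 GV" "l1 (fps_deriv GV)" "l1 (fps_deriv (fps_deriv GV))"
    unfolding d2GV unfolding dGV unfolding GV_def using geo by simp_all
  have GVt: "coeff_sum GV = \<mu>" "coeff_sum (fps_deriv GV) = \<mu>2" "coeff_sum (fps_deriv (fps_deriv GV)) = \<mu>3"
  proof -
    show "coeff_sum GV = \<mu>" unfolding cm(1) using geo by (simp add: GV_def A_def x_def)
    show "coeff_sum (fps_deriv GV) = \<mu>2"
      unfolding dGV cm(2) using geo by (simp add: A_def x_def y_def power_divide power2_eq_square)
    show "coeff_sum (fps_deriv (fps_deriv GV)) = \<mu>3"
      unfolding d2GV cm(3) using geo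
      by (simp add: A_def x_def y_def power_divide power2_eq_square power3_eq_cube mult_ac)
  qed
  \<comment> \<open>Obtained from qh (1 - q X) / (1 - qh X) = q + (qh - q) / (1 - qh X). Its value
    at 1 is r q, which explains the choice of r; the norm of its derivative is \<gamma>.\<close>
  define E' where "E' = fps_const (\<alpha> * q + q) + fps_const (qh - q) * geo_fps qh"
  have E': "?L * GV = E'"
  proof -
    have "fps_const qh * (fps_X * geo_fps qh) = geo_fps qh - 1"
      using geo_fps_inverse[of qh] by (simp add: algebra_simps)
    moreover have "fps_const qh * (?L * geo_fps qh)
        = fps_const qh * geo_fps qh - fps_const q * (fps_const qh * (fps_X * geo_fps qh))"
      by (simp add: algebra_simps)
    ultimately have 1: "fps_const qh * (?L * geo_fps qh) = fps_const qh * geo_fps qh - fps_const q * (geo_fps qh - 1)"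
      by (simp only:)
    have "?L * GV = fps_const (\<alpha> * q) * (?L * geo_fps q) + fps_const qh * (?L * geo_fps qh)"
      unfolding GV_def by (simp add: algebra_simps)
    thus ?thesis unfolding 1 geo_fps_inverse E'_def
      by (simp add: algebra_simps flip: fps_const_add fps_const_sub)
  qed
  have dE': "fps_deriv E' = fps_const ((qh - q) * qh) * geo_fps qh ^ 2"
    by (simp add: E'_def geo_fps_deriv mult.assoc[symmetric])
  have E'l: "l1 E'" "l1 (fps_deriv E')" "coeff_sum E' = r * q" "l1norm (fps_deriv E') = \<gamma>"
  proof -
    show "l1 E'" "l1 (fps_deriv E')" "coeff_sum E' = r * q"
      unfolding dE' using geo by (simp_all add: E'_def rq')
    have "l1norm (fps_deriv E') = \<bar>(qh - q) * qh\<bar> * (1 / (1 - qh)) ^ 2"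
      unfolding dE' using geo qh by (simp add: l1norm_const_mult l1norm_geo_power)
    thus "l1norm (fps_deriv E') = \<gamma>" using qh by (simp add: \<gamma>_def abs_mult power_divide)
  qed
  have d3E': "fps_deriv (fps_deriv (fps_deriv E')) = fps_const ((qh - q) * (6 * qh ^ 3)) * geo_fps qh ^ 4"
  proof -
    have "fps_deriv (fps_deriv (fps_deriv E')) = fps_const (qh - q) * fps_deriv (fps_deriv (fps_deriv (geo_fps qh)))"
      by (simp add: E'_def)
    thus ?thesis unfolding geo_fps_deriv3 by (simp add: mult.assoc[symmetric])
  qed
  have n3E': "l1norm (fps_deriv (fps_deriv (fps_deriv E'))) = 6 * (\<bar>qh - q\<bar> * qh ^ 3 / ph ^ 4)"
  proof -
    have "l1norm (fps_deriv (fps_deriv (fps_deriv E'))) = \<bar>(qh - q) * (6 * qh ^ 3)\<bar> * (1 / (1 - qh)) ^ 4"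
      unfolding d3E' using geo qh by (simp add: l1norm_const_mult l1norm_geo_power)
    thus ?thesis using qh by (simp add: abs_mult power_divide)
  qed

  \<comment> \<open>Third-order contact of the logarithmic derivatives at 1\<close>
  define c where "c = ?L * (GY - GV)"
  have c_eq: "c = ?L * GY - E'" unfolding c_def right_diff_distrib E' ..
  have d3c: "fps_deriv (fps_deriv (fps_deriv c)) = (\<Sum>i=1..n. fps_deriv (fps_deriv (fps_deriv (?L * Gf i)))) - fps_deriv (fps_deriv (fps_deriv E'))"
    unfolding c_eq GY_def sum_distrib_left by (simp only: fps_deriv_sub fps_deriv_sum)
  have l3E': "l1 (fps_deriv (fps_deriv (fps_deriv E')))" unfolding d3E' using geo by simp
  have d3c_l1: "l1 (fps_deriv (fps_deriv (fps_deriv c)))" unfolding d3c using E3(1) l3E' by (intro l1_diff l1_sum) auto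
  have d3c_norm: "l1norm (fps_deriv (fps_deriv (fps_deriv c))) \<le> 6 * K"
  proof -
    have "l1norm (fps_deriv (fps_deriv (fps_deriv c))) \<le> l1norm (\<Sum>i=1..n. fps_deriv (fps_deriv (fps_deriv (?L * Gf i)))) + l1norm (fps_deriv (fps_deriv (fps_deriv E')))"
      unfolding d3c using E3(1) l3E' by (intro l1norm_diff l1_sum) auto
    also have "\<dots> \<le> (\<Sum>i=1..n. l1norm (fps_deriv (fps_deriv (fps_deriv (?L * Gf i))))) + l1norm (fps_deriv (fps_deriv (fps_deriv E')))"
      using E3(1) by (intro add_right_mono l1norm_sum) auto
    also have "\<dots> = 6 * K" unfolding n3E' K_def using E3(2) by (simp add: sum_distrib_left distrib_left)
    finally show ?thesis .
  qed
  \<comment> \<open>By the matching, GY - GV and its first two derivatives vanish at 1;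
    multiplication by 1 - q X preserves this.\<close>
  have ct: "coeff_sum c = 0" "coeff_sum (fps_deriv c) = 0" "coeff_sum (fps_deriv (fps_deriv c)) = 0"
  proof -
    define F where "F = GY - GV"
    have F: "l1 F" "l1 (fps_deriv F)" "l1 (fps_deriv (fps_deriv F))"
        "coeff_sum F = 0" "coeff_sum (fps_deriv F) = 0" "coeff_sum (fps_deriv (fps_deriv F)) = 0"
      unfolding F_def using GYl GYt GVl GVt by simp_all
    have c0: "c = ?L * F" by (simp add: c_def F_def)
    have c1: "fps_deriv c = ?L * fps_deriv F - fps_const q * F" unfolding c0 by (simp add: algebra_simps)
    have c2: "fps_deriv (fps_deriv c) = ?L * fps_deriv (fps_deriv F) - fps_const (2 * q) * fps_deriv F"
      unfolding c1 by (simp add: algebra_simps flip: fps_const_mult numeral_fps_const)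
    show "coeff_sum c = 0" "coeff_sum (fps_deriv c) = 0" "coeff_sum (fps_deriv (fps_deriv c)) = 0"
      unfolding c2 unfolding c1 unfolding c0 using F by simp_all
  qed
  obtain D where D: "c = (1 - fps_X) ^ 3 * D" "l1 D" "6 * l1norm D \<le> l1norm (fps_deriv (fps_deriv (fps_deriv c)))"
    using factor_one_minus_X_cubed[OF d3c_l1 ct] by blast
  have DK: "l1norm D \<le> K" using D(3) d3c_norm by simp
  have D0: "0 \<le> l1norm D" by (rule l1norm_nonneg[OF D(2)])

  \<comment> \<open>Total variation distance as a norm, and the case analysis\<close>
  have MYl: "l1 MY" "coeff_sum MY = 1" unfolding MY_def P_def by (simp_all add: coeff_sum_prod)
  have dMY: "fps_deriv MY = MY * GY" unfolding MY_def GY_def using PG by (rule fps_prod_log_deriv)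
  have MY0: "0 \<le> fps_nth MY 0" "fps_nth MY 0 \<le> exp (- \<Lambda>)"
  proof -
    have "fps_nth MY 0 = (\<Prod>i=1..n. pmf (X i) 0)" unfolding MY_def P_def by (simp add: fps_nth_0_prod)
    thus "0 \<le> fps_nth MY 0" "fps_nth MY 0 \<le> exp (- \<Lambda>)"
      using prod_pmf_0_le[where X = X and n = n] by (simp_all add: prod_nonneg \<Lambda>_def)
  qed
  define d where "d = l1norm (MY - MV) / 2"
  have goal_lhs: "dtv (sum_law X n) (conv (nb_mass \<alpha> p) (geo_mass ph)) = d"
  proof -
    have "conv (nb_mass \<alpha> p) (geo_mass ph) = fps_nth MV"
      using ph_range by (intro ext) (simp add: MV_def conv_def fps_mult_nth atLeast0AtMost geo_mass_eq_nb)
    thus ?thesis unfolding sum_law_eq d_def MY_def P_def by (simp add: dtv_fps)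
  qed
  have MYn: "l1norm MY = 1"
    using l1norm_eq_coeff_sum[of MY] MYl unfolding MY_def P_def by (simp add: fps_prod_nonneg)
  have MVn: "l1norm MV = 1"
    using l1norm_eq_coeff_sum[of MV] MVl nb_mass_pos[OF alpha_pos p_range] nb_mass_pos[OF zero_less_one ph_range]
    unfolding MV_def by (simp add: fps_mult_nonneg less_imp_le)
  have d1: "d \<le> 1" unfolding d_def using l1norm_diff[OF MYl(1) MVl(1)] MYn MVn by simp
  have d0: "0 \<le> d" unfolding d_def using l1norm_nonneg[of "MY - MV"] MYl MVl by simp
  have cond': "0 < r * q - \<gamma>" using cond by (simp add: \<gamma>_def)

  \<comment> \<open>If the claimed bound is at least 1, d <= 1 suffices. Otherwise 16 K < \<Psi> (r
    q - \<gamma>), which both remaining cases exploit.\<close>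
  have main: "d * (\<Psi> * (r * q - \<gamma>)) \<le> 16 * K"
  proof (cases "\<Psi> * (r * q - \<gamma>) \<le> 16 * K")
    case True
    have "d * (\<Psi> * (r * q - \<gamma>)) \<le> 1 * (\<Psi> * (r * q - \<gamma>))"
      using d1 Psi_pos cond' by (intro mult_right_mono) auto
    with True show ?thesis by simp
  next
    case False
    show ?thesis
    proof (cases "y \<le> x")
      case True
      \<comment> \<open>If it failed, p \<mu> = r q <= 3 \<gamma> <= 3 p x^2 would give \<Psi> <=
        \<mu> <= 3 x^2, and r q - \<gamma> <= 2 \<gamma>. The product is at most 6 \<gamma> x^2,
        within 16 K.\<close>
      have small: "3 * \<gamma> < r * q"
      proof (rule ccontr)
        assume "\<not> 3 * \<gamma> < r * q"
        hence big: "r * q \<le> 3 * \<gamma>" by simp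
        have "\<gamma> \<le> p * x ^ 2" unfolding gam power2_eq_square using p_range pos True by simp
        hence "p * \<mu> \<le> p * (3 * x ^ 2)" using big rq by simp
        hence mx: "\<mu> \<le> 3 * x ^ 2" using p_range by simp
        have "\<Psi> * (r * q - \<gamma>) \<le> (3 * x ^ 2) * (2 * \<gamma>)"
          using Psi_le Lam_le mx Psi_pos cond' big by (intro mult_mono) auto
        also have "\<dots> \<le> 16 * (\<gamma> * x ^ 2)" using gam0 by simp
        also have "\<dots> \<le> 16 * K" using KS by simp
        finally show False using False by simp
      qed
      have "d * (r * q - 2 * \<gamma>) \<le> l1norm ((1 - fps_X) ^ 2 * MY) * l1norm D"
        unfolding d_def E'l(4)[symmetric] q_def
      proof (rule stein_perturbation_bound[where E = "?L * GY" and E' = E'])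
        show "l1 (fps_deriv MY)" "l1 (fps_deriv MV)" unfolding dMY dMV using MYl MVl GYl GVl by simp_all
        show "(1 - fps_const (1 - p) * fps_X) * fps_deriv MY = MY * (?L * GY)"
          unfolding dMY q_def by (simp only: mult_ac)
        show "(1 - fps_const (1 - p) * fps_X) * fps_deriv MV = MV * E'"
          unfolding dMV E'[symmetric] q_def by (simp only: mult_ac)
        show "l1 (?L * GY)" using GYl by simp
        show "?L * GY - E' = (1 - fps_X) ^ 3 * D" using D(1) c_eq by simp
        show "coeff_sum E' = r * (1 - p)" using E'l q_def by simp
      qed (use MYl MVl E'l D rpos p_range in auto)
      also have "\<dots> \<le> (8 / \<Lambda>) * K"
      proof (rule mult_mono)
        show "l1norm ((1 - fps_X) ^ 2 * MY) \<le> 8 / \<Lambda>"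
          using sum_second_difference[where X = X and n = n] Psi_pos Psi_le unfolding \<Lambda>_def MY_def P_def by simp
      qed (use DK D0 Psi_pos Psi_le in auto)
      also have "\<dots> \<le> (8 / \<Psi>) * K"
        using Psi_pos Psi_le Knn by (intro mult_right_mono divide_left_mono) auto
      finally have "\<Psi> * (d * (r * q - 2 * \<gamma>)) \<le> 8 * K" using Psi_pos by (simp add: field_simps)
      \<comment> \<open>The Stein bound has r q - 2 \<gamma>; since 3 \<gamma> < r q, twice this
        dominates r q - \<gamma>, which doubles 8 to 16.\<close>
      moreover have "\<Psi> * (d * (r * q - \<gamma>)) \<le> \<Psi> * (d * (2 * (r * q - 2 * \<gamma>)))"
      proof -
        have "z - w \<le> 2 * (z - 2 * w)" if "3 * w < z" for z w :: real using that by simp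
        from this[OF small] show ?thesis by (intro mult_left_mono d0 less_imp_le[OF Psi_pos])
      qed
      ultimately show ?thesis by (simp add: algebra_simps)
    next
      case xy: False
      have Axy: "A + x \<le> y" using discriminant_bound[OF pos(3,1) _ cm(4)] xy by simp
      have "\<alpha> * y \<le> 1 * y" using Axy pos by (simp add: A_def y_def)
      hence alpha1: "\<alpha> \<le> 1" using pos by (simp add: mult_le_cancel_right)
      have "r * q \<le> p * y" unfolding rq cm(1) using Axy p_range by simp
      hence rq1: "r * q - \<gamma> \<le> 1" using qy q(2) gam0 by linarith
      \<comment> \<open>Here r q = p (A + x) <= p y = q < 1, so failure of the trivial case bounds K
        by \<Psi> / 16 and half of the decay exp (- \<Psi>) survives the factor exp (8 K).\<close>
      have "16 * K < \<Psi> * 1" using False mult_left_mono[OF rq1, of \<Psi>] Psi_pos by linarith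
      hence Ksmall: "8 * K - \<Psi> \<le> - \<Psi> / 2" by simp
      have D': "GY - GV = (1 - fps_X) ^ 3 * D * geo_fps (1 - p)"
      proof -
        have "GY - GV = (?L * geo_fps q) * (GY - GV)" by (simp add: geo_fps_inverse)
        also have "\<dots> = c * geo_fps q" unfolding c_def by (simp only: mult_ac)
        finally show ?thesis unfolding D(1) q_def .
      qed
      have "d \<le> 4 * l1norm D * fps_nth MY 0 * exp (8 * l1norm D)"
        unfolding d_def MV_def
        by (rule pgf_ratio_bound[OF MYl MY0(1) dMY dMV[unfolded MV_def] D' D(2) alpha_pos alpha1 p_range ph_range])
      also have "\<dots> \<le> 4 * K * exp (- \<Psi>) * exp (8 * K)"
      proof (intro mult_mono)
        show "fps_nth MY 0 \<le> exp (- \<Psi>)" using MY0(2) Psi_le by (meson exp_le_cancel_iff neg_le_iff_le order_trans)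
      qed (use DK D0 MY0 Knn in auto)
      also have "\<dots> = 4 * K * exp (8 * K - \<Psi>)" by (simp add: exp_diff exp_minus field_simps)
      also have "\<dots> \<le> 4 * K * exp (- \<Psi> / 2)" using Ksmall Knn by (intro mult_left_mono) auto
      finally have dle: "d \<le> 4 * K * exp (- \<Psi> / 2)" .
      \<comment> \<open>The surviving decay absorbs the factor \<Psi> at the cost of 4, so 4 K * 4
        meets the constant 16.\<close>
      have "\<Psi> \<le> 4 * exp (\<Psi> / 2)" using exp_ge_add_one_self[of "\<Psi> / 2"] Psi_pos by linarith
      hence "\<Psi> * exp (- \<Psi> / 2) \<le> 4 * exp (\<Psi> / 2) * exp (- \<Psi> / 2)" by (rule mult_right_mono) simp
      also have "\<dots> = 4" by (simp add: exp_minus)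
      finally have e4: "exp (- \<Psi> / 2) * \<Psi> \<le> 4" by (simp add: mult.commute)
      have "d * (\<Psi> * (r * q - \<gamma>)) \<le> (4 * K * exp (- \<Psi> / 2)) * (\<Psi> * 1)"
        using dle rq1 d0 Psi_pos cond' Knn by (intro mult_mono) auto
      also have "\<dots> = 4 * K * (exp (- \<Psi> / 2) * \<Psi>)" by simp
      also have "\<dots> \<le> 4 * K * 4" using e4 Knn by (intro mult_left_mono) auto
      finally show ?thesis by simp
    qed
  qed
  have "d \<le> 16 * K / (\<Psi> * (r * q - \<gamma>))"
    using main Psi_pos cond' by (simp add: pos_le_divide_eq)
  thus ?thesis unfolding goal_lhs K_def S_def \<gamma>_def by simp
qed

end
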